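(* Let $\mathcal{A}$ be an abelian category, let $\tau\in Pr(\mathcal{A})$, and let $\Delta:Pr(\mathcal{A})\to Pr(\mathcal{A}^{op})$ be the duality assignment $\Delta(\tau)=(\tau^* )^{op}$. Then: (a) $\tau$ is a radical if and only if $\Delta(\tau)$ is idempotent in $Pr(\mathcal{A}^{op})$; (b) $\tau$ is idempotent if and only if $\Delta(\tau)$ is a radical in $Pr(\mathcal{A}^{op})$.
   Context: A preradical of an abelian category $\mathcal{A}$ is a subobject of the identity functor $1_{\mathcal{A}}$ in the (possibly extended) abelian category $\mathrm{Fun}(\mathcal{A},\mathcal{A})$, i.e. the equivalence class of a monomorphic natural transformation $\tau:T\hookrightarrow 1_{\mathcal{A}}$, two such being equivalent if each factors through the other. $Pr(\mathcal{A})$ is the collection of preradicals of $\mathcal{A}$. For $\tau:T\hookrightarrow1_{\mathcal{A}}$, $\tau^*:1_{\mathcal{A}}\twoheadrightarrow T^*$ denotes its cokernel. For a functor $T:\mathcal{A}\to\mathcal{A}$, $T^{op}:\mathcal{A}^{op}\to\mathcal{A}^{op}$ is given by $T^{op}(A)=T(A)$, $T^{op}(f^{op})=T(f)^{op}$; thus $(\tau^* )^{op}:(T^* )^{op}\to 1_{\mathcal{A}^{op}}$ is a preradical of $\mathcal{A}^{op}$. For $\tau:T\hookrightarrow 1_{\mathcal{A}}$ and $\sigma:S\hookrightarrow 1_{\mathcal{A}}$, the product $\tau\cdot\sigma$ is the class of $\sigma\circ\tau S=\tau\circ T\sigma:TS\to 1_{\mathcal{A}}$ (where $(\tau S)_A=\tau_{S(A)}$,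 $(T\sigma)_A=T(\sigma_A)$). The coproduct $(\sigma:\tau)$ is the preradical represented by the pullback of $\tau S^*:TS^*\hookrightarrow S^*$ along $\sigma^*:1_{\mathcal{A}}\to S^*$. A preradical $\tau$ is idempotent if $\tau\cdot\tau=\tau$, and a radical if $(\tau:\tau)=\tau$. The same definitions are used for $\mathcal{A}^{op}$. *)

theory Defs
  imports "HOL-Algebra.Group"
begin

section \<open>Categories\<close>

record ('o, 'm) cat =
  Obj :: "'o set"
  Arr :: "'m set"
  Dom :: "'m \<Rightarrow> 'o"
  Cod :: "'m \<Rightarrow> 'o"
  Id :: "'o \<Rightarrow> 'm"
  Comp :: "'m \<Rightarrow> 'm \<Rightarrow> 'm"  (infixl "\<odot>\<index>" 70)

definition Hom :: "('o, 'm) cat \<Rightarrow> 'o \<Rightarrow> 'o \<Rightarrow> 'm set" where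
  "Hom C a b = {f \<in> Arr C. Dom C f = a \<and> Cod C f = b}"

locale category =
  fixes C :: "('o, 'm) cat" (structure)
  assumes Dom_Obj: "f \<in> Arr C \<Longrightarrow> Dom C f \<in> Obj C"
    and Cod_Obj: "f \<in> Arr C \<Longrightarrow> Cod C f \<in> Obj C"
    and Id_Hom: "a \<in> Obj C \<Longrightarrow> Id C a \<in> Hom C a a"
    and Comp_Hom: "\<lbrakk>f \<in> Hom C a b; g \<in> Hom C b c\<rbrakk> \<Longrightarrow> g \<odot> f \<in> Hom C a c"
    and Comp_assoc: "\<lbrakk>f \<in> Hom C a b; g \<in> Hom C b c; h \<in> Hom C c d\<rbrakk>
          \<Longrightarrow> (h \<odot> g) \<odot> f = h \<odot> (g \<odot> f)"
    and Comp_Id: "f \<in> Hom C a b \<Longrightarrow> f \<odot> Id C a = f"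
    and Id_Comp: "f \<in> Hom C a b \<Longrightarrow> Id C b \<odot> f = f"

text \<open>The opposite category has the same objects and arrows; the arrow \<open>f\<close> of \<open>C\<close>, read in
  \<open>op_cat C\<close>, is the opposite arrow of \<open>f\<close>.\<close>

definition op_cat :: "('o, 'm) cat \<Rightarrow> ('o, 'm) cat" where
  "op_cat C = \<lparr>Obj = Obj C, Arr = Arr C, Dom = Cod C, Cod = Dom C, Id = Id C,
     Comp = (\<lambda>g f. f \<odot>\<^bsub>C\<^esub> g)\<rparr>"

definition monic :: "('o, 'm) cat \<Rightarrow> 'm \<Rightarrow> bool" where
  "monic C m \<longleftrightarrow> m \<in> Arr C \<and>
     (\<forall>x. \<forall>f \<in> Hom C x (Dom C m). \<forall>g \<in> Hom C x (Dom C m).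
        m \<odot>\<^bsub>C\<^esub> f = m \<odot>\<^bsub>C\<^esub> g \<longrightarrow> f = g)"

definition epic :: "('o, 'm) cat \<Rightarrow> 'm \<Rightarrow> bool" where
  "epic C e \<longleftrightarrow> e \<in> Arr C \<and>
     (\<forall>x. \<forall>f \<in> Hom C (Cod C e) x. \<forall>g \<in> Hom C (Cod C e) x.
        f \<odot>\<^bsub>C\<^esub> e = g \<odot>\<^bsub>C\<^esub> e \<longrightarrow> f = g)"

definition zero_object :: "('o, 'm) cat \<Rightarrow> 'o \<Rightarrow> bool" where
  "zero_object C z \<longleftrightarrow> z \<in> Obj C \<and>
     (\<forall>a \<in> Obj C. (\<exists>!f. f \<in> Hom C a z) \<and> (\<exists>!f. f \<in> Hom C z a))"

definition zero_arrow :: "('o, 'm) cat \<Rightarrow> 'm \<Rightarrow> bool" where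
  "zero_arrow C f \<longleftrightarrow> f \<in> Arr C \<and>
     (\<exists>z. zero_object C z \<and>
        (\<exists>g \<in> Hom C (Dom C f) z. \<exists>h \<in> Hom C z (Cod C f). f = h \<odot>\<^bsub>C\<^esub> g))"

definition is_kernel :: "('o, 'm) cat \<Rightarrow> 'm \<Rightarrow> 'm \<Rightarrow> bool" where
  "is_kernel C k f \<longleftrightarrow> f \<in> Arr C \<and> k \<in> Arr C \<and> Cod C k = Dom C f \<and> zero_arrow C (f \<odot>\<^bsub>C\<^esub> k) \<and>
     (\<forall>x. \<forall>g \<in> Hom C x (Dom C f). zero_arrow C (f \<odot>\<^bsub>C\<^esub> g) \<longrightarrow>
        (\<exists>!u. u \<in> Hom C x (Dom C k) \<and> k \<odot>\<^bsub>C\<^esub> u = g))"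

definition is_cokernel :: "('o, 'm) cat \<Rightarrow> 'm \<Rightarrow> 'm \<Rightarrow> bool" where
  "is_cokernel C c f \<longleftrightarrow> f \<in> Arr C \<and> c \<in> Arr C \<and> Dom C c = Cod C f \<and> zero_arrow C (c \<odot>\<^bsub>C\<^esub> f) \<and>
     (\<forall>x. \<forall>g \<in> Hom C (Cod C f) x. zero_arrow C (g \<odot>\<^bsub>C\<^esub> f) \<longrightarrow>
        (\<exists>!u. u \<in> Hom C (Cod C c) x \<and> u \<odot>\<^bsub>C\<^esub> c = g))"

text \<open>\<open>is_pullback C f g p q\<close>: the span \<open>(p, q)\<close> is a pullback of the cospan \<open>(f, g)\<close>, so that
  \<open>p\<close> is the pullback of \<open>g\<close> along \<open>f\<close>.\<close>

definition is_pullback :: "('o, 'm) cat \<Rightarrow> 'm \<Rightarrow> 'm \<Rightarrow> 'm \<Rightarrow> 'm \<Rightarrow> bool" where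
  "is_pullback C f g p q \<longleftrightarrow>
     f \<in> Arr C \<and> g \<in> Arr C \<and> p \<in> Arr C \<and> q \<in> Arr C \<and> Cod C f = Cod C g \<and>
     Cod C p = Dom C f \<and> Cod C q = Dom C g \<and> Dom C p = Dom C q \<and> f \<odot>\<^bsub>C\<^esub> p = g \<odot>\<^bsub>C\<^esub> q \<and>
     (\<forall>x. \<forall>h \<in> Hom C x (Dom C f). \<forall>k \<in> Hom C x (Dom C g). f \<odot>\<^bsub>C\<^esub> h = g \<odot>\<^bsub>C\<^esub> k \<longrightarrow>
        (\<exists>!u. u \<in> Hom C x (Dom C p) \<and> p \<odot>\<^bsub>C\<^esub> u = h \<and> q \<odot>\<^bsub>C\<^esub> u = k))"


section \<open>Abelian categories\<close>

text \<open>Mac Lane's definition. The addition of arrows is determined by the category, so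
  being abelian is a property of the category rather than additional structure.\<close>

definition preadditive :: "('o, 'm) cat \<Rightarrow> ('m \<Rightarrow> 'm \<Rightarrow> 'm) \<Rightarrow> bool" where
  "preadditive C add \<longleftrightarrow>
     (\<forall>a \<in> Obj C. \<forall>b \<in> Obj C. \<exists>z. comm_group \<lparr>carrier = Hom C a b, mult = add, one = z\<rparr>) \<and>
     (\<forall>a b c. \<forall>f \<in> Hom C a b. \<forall>f' \<in> Hom C a b. \<forall>g \<in> Hom C b c. \<forall>g' \<in> Hom C b c.
        g \<odot>\<^bsub>C\<^esub> (add f f') = add (g \<odot>\<^bsub>C\<^esub> f) (g \<odot>\<^bsub>C\<^esub> f') \<and>
        (add g g') \<odot>\<^bsub>C\<^esub> f = add (g \<odot>\<^bsub>C\<^esub> f) (g' \<odot>\<^bsub>C\<^esub> f))"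

definition has_biproduct :: "('o, 'm) cat \<Rightarrow> ('m \<Rightarrow> 'm \<Rightarrow> 'm) \<Rightarrow> 'o \<Rightarrow> 'o \<Rightarrow> bool" where
  "has_biproduct C add a b \<longleftrightarrow>
     (\<exists>s \<in> Obj C. \<exists>i \<in> Hom C a s. \<exists>j \<in> Hom C b s. \<exists>p \<in> Hom C s a. \<exists>q \<in> Hom C s b.
        p \<odot>\<^bsub>C\<^esub> i = Id C a \<and> q \<odot>\<^bsub>C\<^esub> j = Id C b \<and>
        add (i \<odot>\<^bsub>C\<^esub> p) (j \<odot>\<^bsub>C\<^esub> q) = Id C s)"

locale abelian_category = category C for C :: "('o, 'm) cat" (structure) +
  assumes ex_zero_object: "\<exists>z. zero_object C z"
    and additive: "\<exists>add. preadditive C add \<and> (\<forall>a \<in> Obj C. \<forall>b \<in> Obj C. has_biproduct C add a b)"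
    and ex_kernel: "f \<in> Arr C \<Longrightarrow> \<exists>k. is_kernel C k f"
    and ex_cokernel: "f \<in> Arr C \<Longrightarrow> \<exists>c. is_cokernel C c f"
    and monic_normal: "monic C m \<Longrightarrow> \<exists>f. is_kernel C m f"
    and epic_normal: "epic C e \<Longrightarrow> \<exists>f. is_cokernel C e f"


section \<open>Functor categories\<close>

text \<open>Object and arrow maps of functors, and the families of components of natural
  transformations, are extensional (\<open>undefined\<close> off the source category), so that equality
  in HOL is equality of functors and of natural transformations.\<close>

record ('o, 'm, 'p, 'n) fctor =
  FObj :: "'o \<Rightarrow> 'p"
  FArr :: "'m \<Rightarrow> 'n"

definition is_functor :: "('o, 'm) cat \<Rightarrow> ('p, 'n) cat \<Rightarrow> ('o, 'm, 'p, 'n) fctor \<Rightarrow> bool" where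
  "is_functor C D F \<longleftrightarrow>
     FObj F \<in> Obj C \<rightarrow>\<^sub>E Obj D \<and> FArr F \<in> Arr C \<rightarrow>\<^sub>E Arr D \<and>
     (\<forall>f \<in> Arr C. FArr F f \<in> Hom D (FObj F (Dom C f)) (FObj F (Cod C f))) \<and>
     (\<forall>a \<in> Obj C. FArr F (Id C a) = Id D (FObj F a)) \<and>
     (\<forall>f \<in> Arr C. \<forall>g \<in> Arr C. Dom C g = Cod C f \<longrightarrow>
        FArr F (g \<odot>\<^bsub>C\<^esub> f) = FArr F g \<odot>\<^bsub>D\<^esub> FArr F f)"

definition id_functor :: "('o, 'm) cat \<Rightarrow> ('o, 'm, 'o, 'm) fctor" where
  "id_functor C = \<lparr>FObj = (\<lambda>a \<in> Obj C. a), FArr = (\<lambda>f \<in> Arr C. f)\<rparr>"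

definition comp_functor ::
  "('o, 'm) cat \<Rightarrow> ('p, 'n, 'q, 'r) fctor \<Rightarrow> ('o, 'm, 'p, 'n) fctor \<Rightarrow> ('o, 'm, 'q, 'r) fctor" where
  "comp_functor C G F =
     \<lparr>FObj = compose (Obj C) (FObj G) (FObj F), FArr = compose (Arr C) (FArr G) (FArr F)\<rparr>"

record ('o, 'm, 'p, 'n) nat_trans =
  Src :: "('o, 'm, 'p, 'n) fctor"
  Tgt :: "('o, 'm, 'p, 'n) fctor"
  Cpt :: "'o \<Rightarrow> 'n"

definition is_nat_trans ::
  "('o, 'm) cat \<Rightarrow> ('p, 'n) cat \<Rightarrow> ('o, 'm, 'p, 'n) nat_trans \<Rightarrow> bool" where
  "is_nat_trans C D t \<longleftrightarrow>
     is_functor C D (Src t) \<and> is_functor C D (Tgt t) \<and> Cpt t \<in> extensional (Obj C) \<and>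
     (\<forall>a \<in> Obj C. Cpt t a \<in> Hom D (FObj (Src t) a) (FObj (Tgt t) a)) \<and>
     (\<forall>f \<in> Arr C. FArr (Tgt t) f \<odot>\<^bsub>D\<^esub> Cpt t (Dom C f) = Cpt t (Cod C f) \<odot>\<^bsub>D\<^esub> FArr (Src t) f)"

definition functor_category :: "('o, 'm) cat \<Rightarrow> ('p, 'n) cat \<Rightarrow>
    (('o, 'm, 'p, 'n) fctor, ('o, 'm, 'p, 'n) nat_trans) cat" where
  "functor_category C D =
     \<lparr>Obj = {F. is_functor C D F}, Arr = {t. is_nat_trans C D t}, Dom = Src, Cod = Tgt,
      Id = (\<lambda>F. \<lparr>Src = F, Tgt = F, Cpt = (\<lambda>a \<in> Obj C. Id D (FObj F a))\<rparr>),
      Comp = (\<lambda>t s. \<lparr>Src = Src s, Tgt = Tgt t, Cpt = (\<lambda>a \<in> Obj C. Cpt t a \<odot>\<^bsub>D\<^esub> Cpt s a)\<rparr>)\<rparr>"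

text \<open>\<open>whisker C t S\<close> is the natural transformation with components \<open>t\<^bsub>S(a)\<^esub>\<close>, usually
  written \<open>tS\<close>.\<close>

definition whisker :: "('o, 'm) cat \<Rightarrow> ('p, 'n, 'q, 'r) nat_trans \<Rightarrow> ('o, 'm, 'p, 'n) fctor
    \<Rightarrow> ('o, 'm, 'q, 'r) nat_trans" where
  "whisker C t S = \<lparr>Src = comp_functor C (Src t) S, Tgt = comp_functor C (Tgt t) S,
     Cpt = compose (Obj C) (Cpt t) (FObj S)\<rparr>"

text \<open>For \<open>t : F \<longrightarrow> G\<close> this is \<open>t\<^sup>o\<^sup>p : G\<^sup>o\<^sup>p \<longrightarrow> F\<^sup>o\<^sup>p\<close>. Since \<open>op_cat C\<close> shares objects and
  arrows with \<open>C\<close>, the functor \<open>F\<^sup>o\<^sup>p\<close> is given by the same object and arrow maps as \<open>F\<close>.\<close>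

definition op_nat_trans :: "('o, 'm, 'p, 'n) nat_trans \<Rightarrow> ('o, 'm, 'p, 'n) nat_trans" where
  "op_nat_trans t = \<lparr>Src = Tgt t, Tgt = Src t, Cpt = Cpt t\<rparr>"


section \<open>Subobjects and preradicals\<close>

definition factors_through :: "('o, 'm) cat \<Rightarrow> 'm \<Rightarrow> 'm \<Rightarrow> bool" where
  "factors_through C m n \<longleftrightarrow> (\<exists>u \<in> Hom C (Dom C m) (Dom C n). n \<odot>\<^bsub>C\<^esub> u = m)"

definition monics_into :: "('o, 'm) cat \<Rightarrow> 'o \<Rightarrow> 'm set" where
  "monics_into C x = {m. monic C m \<and> Cod C m = x}"

definition sub_equiv :: "('o, 'm) cat \<Rightarrow> 'o \<Rightarrow> ('m \<times> 'm) set" where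
  "sub_equiv C x = {(m, n). m \<in> monics_into C x \<and> n \<in> monics_into C x \<and>
     factors_through C m n \<and> factors_through C n m}"

definition subobjects :: "('o, 'm) cat \<Rightarrow> 'o \<Rightarrow> 'm set set" where
  "subobjects C x = monics_into C x // sub_equiv C x"

type_synonym ('o, 'm) preradical = "('o, 'm, 'o, 'm) nat_trans set"

definition Pr :: "('o, 'm) cat \<Rightarrow> ('o, 'm) preradical set" where
  "Pr C = subobjects (functor_category C C) (id_functor C)"

definition pr_class :: "('o, 'm) cat \<Rightarrow> ('o, 'm, 'o, 'm) nat_trans \<Rightarrow> ('o, 'm) preradical" where
  "pr_class C t = sub_equiv (functor_category C C) (id_functor C) `` {t}"

text \<open>The operations below are defined on representatives and lifted to classes by taking the
  union, over all choices of representatives, cokernels and pullbacks, of the classes obtained;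
  these classes all coincide.

  \<open>pr_product C \<tau> \<sigma>\<close> is the product \<open>\<tau> \<cdot> \<sigma>\<close>, represented by \<open>s \<circ> tS\<close>.\<close>

definition pr_product ::
  "('o, 'm) cat \<Rightarrow> ('o, 'm) preradical \<Rightarrow> ('o, 'm) preradical \<Rightarrow> ('o, 'm) preradical" where
  "pr_product C \<tau> \<sigma> =
     \<Union>{pr_class C (s \<odot>\<^bsub>functor_category C C\<^esub> whisker C t (Src s)) | t s. t \<in> \<tau> \<and> s \<in> \<sigma>}"

text \<open>\<open>pr_coproduct C \<sigma> \<tau>\<close> is the coproduct \<open>(\<sigma> : \<tau>)\<close>; here \<open>c : 1 \<longrightarrow> S\<^sup>*\<close> is a cokernel of \<open>s\<close>.\<close>

definition pr_coproduct ::
  "('o, 'm) cat \<Rightarrow> ('o, 'm) preradical \<Rightarrow> ('o, 'm) preradical \<Rightarrow> ('o, 'm) preradical" where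
  "pr_coproduct C \<sigma> \<tau> =
     \<Union>{pr_class C p | p q s t c. s \<in> \<sigma> \<and> t \<in> \<tau> \<and> is_cokernel (functor_category C C) c s \<and>
          is_pullback (functor_category C C) c (whisker C t (Tgt c)) p q}"

definition pr_idempotent :: "('o, 'm) cat \<Rightarrow> ('o, 'm) preradical \<Rightarrow> bool" where
  "pr_idempotent C \<tau> \<longleftrightarrow> pr_product C \<tau> \<tau> = \<tau>"

definition pr_radical :: "('o, 'm) cat \<Rightarrow> ('o, 'm) preradical \<Rightarrow> bool" where
  "pr_radical C \<tau> \<longleftrightarrow> pr_coproduct C \<tau> \<tau> = \<tau>"

definition pr_dual :: "('o, 'm) cat \<Rightarrow> ('o, 'm) preradical \<Rightarrow> ('o, 'm) preradical" where
  "pr_dual C \<tau> = \<Union>{pr_class (op_cat C) (op_nat_trans c) | t c.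
     t \<in> \<tau> \<and> is_cokernel (functor_category C C) c t}"


section \<open>The duality takes preradicals to preradicals\<close>

text \<open>The result is \<open>pr_dual_in_Pr\<close> at the end. Its main ingredient is that cokernels in a functor
  category with abelian target exist and are computed componentwise.\<close>

lemma category_op: "category C \<Longrightarrow> category (op_cat C)"
  unfolding category_def op_cat_def Hom_def by auto

lemma HomI: "f \<in> Arr C \<Longrightarrow> f \<in> Hom C (Dom C f) (Cod C f)"
  by (simp add: Hom_def)

lemma HomD: "f \<in> Hom C a b \<Longrightarrow> f \<in> Arr C \<and> Dom C f = a \<and> Cod C f = b"
  by (simp add: Hom_def)

lemma fc_sel:
  "Obj (functor_category C D) = {F. is_functor C D F}"
  "Arr (functor_category C D) = {t. is_nat_trans C D t}"
  "Dom (functor_category C D) = Src"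
  "Cod (functor_category C D) = Tgt"
  "Id (functor_category C D) F = \<lparr>Src = F, Tgt = F, Cpt = (\<lambda>a \<in> Obj C. Id D (FObj F a))\<rparr>"
  "t \<odot>\<^bsub>functor_category C D\<^esub> s =
     \<lparr>Src = Src s, Tgt = Tgt t, Cpt = (\<lambda>a \<in> Obj C. Cpt t a \<odot>\<^bsub>D\<^esub> Cpt s a)\<rparr>"
  by (simp_all add: functor_category_def)

lemma nt_eqI:
  assumes "is_nat_trans C D s" "is_nat_trans C D t" "Src s = Src t" "Tgt s = Tgt t"
    "\<And>a. a \<in> Obj C \<Longrightarrow> Cpt s a = Cpt t a"
  shows "s = t"
proof -
  have "Cpt s = Cpt t" using assms by (intro extensionalityI) (auto simp: is_nat_trans_def)
  then show ?thesis using assms by simp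
qed

lemma Id_nt: assumes "category C" "category D" "is_functor C D F"
  shows "is_nat_trans C D \<lparr>Src = F, Tgt = F, Cpt = (\<lambda>a \<in> Obj C. Id D (FObj F a))\<rparr>"
proof -
  interpret C: category C by fact
  interpret D: category D by fact
  have "FObj F a \<in> Obj D" if "a \<in> Obj C" for a using assms(3) that by (auto simp: is_functor_def)
  then show ?thesis using assms(3)
    by (auto simp: is_nat_trans_def is_functor_def C.Dom_Obj C.Cod_Obj D.Id_Hom D.Id_Comp D.Comp_Id PiE_mem)
qed

lemma Comp_nt: assumes "category C" "category D" "is_nat_trans C D s" "is_nat_trans C D t" "Src t = Tgt s"
  shows "is_nat_trans C D \<lparr>Src = Src s, Tgt = Tgt t, Cpt = (\<lambda>a \<in> Obj C. Cpt t a \<odot>\<^bsub>D\<^esub> Cpt s a)\<rparr>"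
proof -
  interpret C: category C by fact
  interpret D: category D by fact
  note d = C.Dom_Obj C.Cod_Obj
  { fix f assume f: "f \<in> Arr C"
    let ?a = "Dom C f" and ?b = "Cod C f"
    have 1: "FArr (Src s) f \<in> Hom D (FObj (Src s) ?a) (FObj (Src s) ?b)"
      "FArr (Tgt s) f \<in> Hom D (FObj (Tgt s) ?a) (FObj (Tgt s) ?b)"
      "FArr (Tgt t) f \<in> Hom D (FObj (Tgt t) ?a) (FObj (Tgt t) ?b)"
      using assms f by (auto simp: is_nat_trans_def is_functor_def)
    have 2: "\<And>x. x \<in> Obj C \<Longrightarrow> Cpt s x \<in> Hom D (FObj (Src s) x) (FObj (Tgt s) x)"
      "\<And>x. x \<in> Obj C \<Longrightarrow> Cpt t x \<in> Hom D (FObj (Tgt s) x) (FObj (Tgt t) x)"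
      using assms by (auto simp: is_nat_trans_def)
    have 3: "FArr (Tgt s) f \<odot>\<^bsub>D\<^esub> Cpt s ?a = Cpt s ?b \<odot>\<^bsub>D\<^esub> FArr (Src s) f"
      "FArr (Tgt t) f \<odot>\<^bsub>D\<^esub> Cpt t ?a = Cpt t ?b \<odot>\<^bsub>D\<^esub> FArr (Tgt s) f"
      using assms f by (auto simp: is_nat_trans_def)
    have "FArr (Tgt t) f \<odot>\<^bsub>D\<^esub> (Cpt t ?a \<odot>\<^bsub>D\<^esub> Cpt s ?a)
        = (Cpt t ?b \<odot>\<^bsub>D\<^esub> Cpt s ?b) \<odot>\<^bsub>D\<^esub> FArr (Src s) f"
      using D.Comp_assoc[OF 2(1)[OF d(1)[OF f]] 2(2)[OF d(1)[OF f]] 1(3)]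
        D.Comp_assoc[OF 2(1)[OF d(1)[OF f]] 1(2) 2(2)[OF d(2)[OF f]]]
        D.Comp_assoc[OF 1(1) 2(1)[OF d(2)[OF f]] 2(2)[OF d(2)[OF f]]] 3 by metis }
  then show ?thesis using assms
    by (auto simp: is_nat_trans_def d intro: D.Comp_Hom)
qed

lemma category_fc: assumes "category C" "category D" shows "category (functor_category C D)"
proof -
  interpret C: category C by fact
  interpret D: category D by fact
  have H: "Hom (functor_category C D) F G = {t. is_nat_trans C D t \<and> Src t = F \<and> Tgt t = G}" for F G
    by (simp add: Hom_def fc_sel)
  show ?thesis
  proof (unfold_locales, unfold H fc_sel, goal_cases)
    case (1 f) then show ?case by (simp add: is_nat_trans_def)
  next
    case (2 f) then show ?case by (simp add: is_nat_trans_def)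
  next
    case (3 a) then show ?case using Id_nt[OF assms] by simp
  next
    case (4 f a b g c) then show ?case using Comp_nt[OF assms, of f g] by auto
  next
    case (5 f a b g c h d)
    have "Cpt f x \<in> Hom D (FObj a x) (FObj b x)" "Cpt g x \<in> Hom D (FObj b x) (FObj c x)"
      "Cpt h x \<in> Hom D (FObj c x) (FObj d x)" if "x \<in> Obj C" for x
      using 5 that by (auto simp: is_nat_trans_def)
    then show ?case using 5 by (auto intro!: restrict_ext D.Comp_assoc)
  next
    case (6 f a b)
    then have f: "is_nat_trans C D f" "Src f = a" "Tgt f = b" "is_functor C D a" by (auto simp: is_nat_trans_def)
    have h: "Cpt f x \<in> Hom D (FObj a x) (FObj b x)" if "x \<in> Obj C" for x
      using f that by (auto simp: is_nat_trans_def)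
    show ?case
    proof (rule nt_eqI[OF Comp_nt[OF assms Id_nt[OF assms f(4)] f(1)] f(1)])
    qed (use f h D.Comp_Id in \<open>auto simp: fc_sel\<close>)
  next
    case (7 f a b)
    then have f: "is_nat_trans C D f" "Src f = a" "Tgt f = b" "is_functor C D b" by (auto simp: is_nat_trans_def)
    have h: "Cpt f x \<in> Hom D (FObj a x) (FObj b x)" if "x \<in> Obj C" for x
      using f that by (auto simp: is_nat_trans_def)
    show ?case
    proof (rule nt_eqI[OF Comp_nt[OF assms f(1) Id_nt[OF assms f(4)]] f(1)])
    qed (use f h D.Id_Comp in \<open>auto simp: fc_sel\<close>)
  qed
qed

lemma (in category) Comp_Hom': "\<lbrakk>f \<in> Arr C; g \<in> Arr C; Dom C g = Cod C f\<rbrakk>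
   \<Longrightarrow> g \<odot> f \<in> Hom C (Dom C f) (Cod C g)"
  using Comp_Hom by (auto simp: Hom_def)

lemma (in category) zero_arrow_post:
  assumes "zero_arrow C f" "f \<in> Hom C a b" "g \<in> Hom C b c" shows "zero_arrow C (g \<odot> f)"
proof -
  obtain z p q where z: "zero_object C z" "p \<in> Hom C a z" "q \<in> Hom C z b" "f = q \<odot> p"
    using assms HomD unfolding zero_arrow_def by metis
  have "g \<odot> f = (g \<odot> q) \<odot> p" using z assms Comp_assoc by metis
  moreover have "g \<odot> q \<in> Hom C z c" "g \<odot> f \<in> Hom C a c" using z assms Comp_Hom by blast+
  ultimately show ?thesis using z HomD unfolding zero_arrow_def by metis
qed

lemma (in category) zero_arrow_pre:
  assumes "zero_arrow C f" "f \<in> Hom C a b" "g \<in> Hom C c a" shows "zero_arrow C (f \<odot> g)"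
proof -
  obtain z p q where z: "zero_object C z" "p \<in> Hom C a z" "q \<in> Hom C z b" "f = q \<odot> p"
    using assms HomD unfolding zero_arrow_def by metis
  have "f \<odot> g = q \<odot> (p \<odot> g)" using z assms Comp_assoc by metis
  moreover have "p \<odot> g \<in> Hom C c z" "f \<odot> g \<in> Hom C c b" using z assms Comp_Hom by blast+
  ultimately show ?thesis using z HomD unfolding zero_arrow_def by metis
qed

lemma zero_objectD:
  assumes "zero_object C z" "a \<in> Obj C"
  shows "\<exists>f. f \<in> Hom C a z" "\<exists>f. f \<in> Hom C z a"
    "\<lbrakk>f \<in> Hom C a z; g \<in> Hom C a z\<rbrakk> \<Longrightarrow> f = g" "\<lbrakk>f \<in> Hom C z a; g \<in> Hom C z a\<rbrakk> \<Longrightarrow> f = g"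
proof -
  have "(\<exists>!f. f \<in> Hom C a z)" "(\<exists>!f. f \<in> Hom C z a)" using assms by (auto simp: zero_object_def)
  then show "\<exists>f. f \<in> Hom C a z" "\<exists>f. f \<in> Hom C z a"
    "\<lbrakk>f \<in> Hom C a z; g \<in> Hom C a z\<rbrakk> \<Longrightarrow> f = g" "\<lbrakk>f \<in> Hom C z a; g \<in> Hom C z a\<rbrakk> \<Longrightarrow> f = g"
    by metis+
qed

lemma (in category) zero_arrow_through:
  assumes "zero_arrow C f" "f \<in> Hom C a b" "zero_object C z"
    "p \<in> Hom C a z" "q \<in> Hom C z b"
  shows "f = q \<odot> p"
proof -
  obtain w p' q' where w: "zero_object C w" "p' \<in> Hom C a w" "q' \<in> Hom C w b" "f = q' \<odot> p'"
    using assms HomD unfolding zero_arrow_def by metis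
  have "w \<in> Obj C" using w(1) by (simp add: zero_object_def)
  then obtain i where i: "i \<in> Hom C w z" using zero_objectD(1)[OF assms(3)] by blast
  have a: "a \<in> Obj C" "b \<in> Obj C" using assms Dom_Obj Cod_Obj HomD by metis+
  have "i \<odot> p' = p" using zero_objectD(3)[OF assms(3) a(1) Comp_Hom[OF w(2) i] assms(4)] .
  moreover have "q \<odot> i = q'" using zero_objectD(4)[OF w(1) a(2) Comp_Hom[OF i assms(5)] w(3)] .
  ultimately show ?thesis using Comp_assoc[OF w(2) i assms(5)] w by simp
qed

lemma (in category) cokernel_epic: assumes "is_cokernel C c f" shows "epic C c"
  unfolding epic_def
proof (intro conjI allI ballI impI)
  have c: "f \<in> Arr C" "c \<in> Arr C" "Dom C c = Cod C f" "zero_arrow C (c \<odot> f)"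
    using assms by (auto simp: is_cokernel_def)
  show "c \<in> Arr C" by fact
  fix x g h assume g: "g \<in> Hom C (Cod C c) x" and h: "h \<in> Hom C (Cod C c) x" and e: "g \<odot> c = h \<odot> c"
  have f: "f \<in> Hom C (Dom C f) (Cod C f)" and cc: "c \<in> Hom C (Cod C f) (Cod C c)"
    using c by (auto simp: Hom_def)
  have "zero_arrow C (g \<odot> (c \<odot> f))" by (rule zero_arrow_post[OF c(4) Comp_Hom[OF f cc] g])
  then have "zero_arrow C ((g \<odot> c) \<odot> f)" using Comp_assoc[OF f cc g] by simp
  then have "\<exists>!u. u \<in> Hom C (Cod C c) x \<and> u \<odot> c = g \<odot> c"
    using assms Comp_Hom[OF cc g] unfolding is_cokernel_def by blast
  then show "g = h" using g h e by metis
qed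

lemma (in category) cokernels_factor:
  assumes "is_cokernel C c f" "is_cokernel C d g" "factors_through C f g" "Cod C f = Cod C g"
  shows "\<exists>u \<in> Hom C (Cod C c) (Cod C d). u \<odot> c = d"
proof -
  obtain v where v: "v \<in> Hom C (Dom C f) (Dom C g)" "g \<odot> v = f"
    using assms by (auto simp: factors_through_def)
  have d: "d \<in> Hom C (Cod C g) (Cod C d)" "g \<in> Hom C (Dom C g) (Cod C g)"
    using assms by (auto simp: Hom_def is_cokernel_def)
  have "zero_arrow C ((d \<odot> g) \<odot> v)"
    using zero_arrow_pre[OF _ Comp_Hom[OF d(2,1)] v(1)] assms(2) by (simp add: is_cokernel_def)
  then have "zero_arrow C (d \<odot> f)" using Comp_assoc[OF v(1) d(2,1)] v(2) by simp
  then show ?thesis using assms d unfolding is_cokernel_def by (metis)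
qed

lemma op_sel: "Obj (op_cat C) = Obj C" "Arr (op_cat C) = Arr C" "Dom (op_cat C) = Cod C"
  "Cod (op_cat C) = Dom C" "Id (op_cat C) = Id C" "Hom (op_cat C) a b = Hom C b a"
  "g \<odot>\<^bsub>op_cat C\<^esub> f = f \<odot>\<^bsub>C\<^esub> g" "op_cat (op_cat C) = C"
  by (auto simp: op_cat_def Hom_def)

lemma is_functor_op: "is_functor (op_cat C) (op_cat D) F \<longleftrightarrow> is_functor C D F"
  unfolding is_functor_def op_sel by auto

lemma op_nt_sel: "Src (op_nat_trans t) = Tgt t" "Tgt (op_nat_trans t) = Src t" "Cpt (op_nat_trans t) = Cpt t"
   "op_nat_trans (op_nat_trans t) = t"
  by (simp_all add: op_nat_trans_def)

lemma is_nat_trans_op: "is_nat_trans (op_cat C) (op_cat D) (op_nat_trans t) \<longleftrightarrow> is_nat_trans C D t"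
  unfolding is_nat_trans_def op_sel op_nt_sel is_functor_op by auto

lemma id_functor_op: "id_functor (op_cat C) = id_functor C"
  by (simp add: id_functor_def op_sel)

lemma comp_op: "op_nat_trans t \<odot>\<^bsub>functor_category (op_cat C) (op_cat D)\<^esub> op_nat_trans s
   = op_nat_trans (s \<odot>\<^bsub>functor_category C D\<^esub> t)"
  by (simp add: fc_sel op_sel op_nt_sel op_nat_trans_def)

lemma Hom_op: "op_nat_trans t \<in> Hom (functor_category (op_cat C) (op_cat D)) F G
   \<longleftrightarrow> t \<in> Hom (functor_category C D) G F"
  by (auto simp: Hom_def fc_sel is_nat_trans_op op_nt_sel)

lemma monic_op: assumes "epic (functor_category C D) e"
  shows "monic (functor_category (op_cat C) (op_cat D)) (op_nat_trans e)"
  unfolding monic_def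
proof (intro conjI allI ballI impI)
  let ?F = "functor_category C D" and ?G = "functor_category (op_cat C) (op_cat D)"
  show "op_nat_trans e \<in> Arr ?G" using assms by (simp add: epic_def fc_sel is_nat_trans_op)
  fix x f g assume "f \<in> Hom ?G x (Dom ?G (op_nat_trans e))" "g \<in> Hom ?G x (Dom ?G (op_nat_trans e))"
    and e: "op_nat_trans e \<odot>\<^bsub>?G\<^esub> f = op_nat_trans e \<odot>\<^bsub>?G\<^esub> g"
  then have "op_nat_trans f \<in> Hom ?F (Cod ?F e) x" "op_nat_trans g \<in> Hom ?F (Cod ?F e) x"
    using Hom_op[of "op_nat_trans f" C D] Hom_op[of "op_nat_trans g" C D]
    by (simp_all add: op_nt_sel fc_sel)
  moreover have "op_nat_trans f \<odot>\<^bsub>?F\<^esub> e = op_nat_trans g \<odot>\<^bsub>?F\<^esub> e"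
    using e comp_op[of C D e "op_nat_trans f"] comp_op[of C D e "op_nat_trans g"] by (metis op_nt_sel(4))
  ultimately have "op_nat_trans f = op_nat_trans g" using assms unfolding epic_def by blast
  then show "f = g" by (metis op_nt_sel(4))
qed

lemma zero_functor:
  assumes "category C" "category D" "zero_object D z"
  shows "zero_object (functor_category C D) \<lparr>FObj = \<lambda>a\<in>Obj C. z, FArr = \<lambda>f\<in>Arr C. Id D z\<rparr>" (is "zero_object _ ?Z")
proof -
  interpret C: category C by fact
  interpret D: category D by fact
  have z: "z \<in> Obj D" "Id D z \<in> Hom D z z" using assms D.Id_Hom by (auto simp: zero_object_def)
  have zz: "Id D z \<odot>\<^bsub>D\<^esub> Id D z = Id D z" using z D.Id_Comp by blast
  have u: "\<And>a f g. a \<in> Obj D \<Longrightarrow> f \<in> Hom D a z \<Longrightarrow> g \<in> Hom D a z \<Longrightarrow> f = g"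
    "\<And>a f g. a \<in> Obj D \<Longrightarrow> f \<in> Hom D z a \<Longrightarrow> g \<in> Hom D z a \<Longrightarrow> f = g"
    using zero_objectD(3,4)[OF assms(3)] by blast+
  define p where "p = (\<lambda>a. SOME f. f \<in> Hom D a z)"
  define q where "q = (\<lambda>a. SOME f. f \<in> Hom D z a)"
  have p: "p a \<in> Hom D a z" and q: "q a \<in> Hom D z a" if "a \<in> Obj D" for a
    using zero_objectD(1,2)[OF assms(3) that] unfolding p_def q_def by (auto intro: someI_ex)
  have idA: "f \<in> Arr C \<Longrightarrow> Dom C f \<in> Obj C \<and> Cod C f \<in> Obj C" for f using C.Dom_Obj C.Cod_Obj by auto
  have Z: "is_functor C D ?Z"
    unfolding is_functor_def using z zz C.Dom_Obj C.Cod_Obj C.Id_Hom C.Comp_Hom'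
    by (auto simp: Hom_def)
  show ?thesis unfolding zero_object_def
  proof (intro conjI ballI)
    show "?Z \<in> Obj (functor_category C D)" using Z by (simp add: fc_sel)
    fix F assume "F \<in> Obj (functor_category C D)"
    then have F: "is_functor C D F" by (simp add: fc_sel)
    have FO: "FObj F a \<in> Obj D" if "a \<in> Obj C" for a using F that by (auto simp: is_functor_def)
    have FA: "FArr F f \<in> Hom D (FObj F (Dom C f)) (FObj F (Cod C f))" if "f \<in> Arr C" for f
      using F that by (auto simp: is_functor_def)
    show "\<exists>!f. f \<in> Hom (functor_category C D) F ?Z"
    proof (rule ex1I)
      let ?t = "\<lparr>Src = F, Tgt = ?Z, Cpt = \<lambda>a\<in>Obj C. p (FObj F a)\<rparr>"
      have "is_nat_trans C D ?t" unfolding is_nat_trans_def using F Z FO p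
        by (auto simp: idA intro!: u(1)[OF FO] D.Comp_Hom[OF _ z(2)] D.Comp_Hom[OF FA])
      then show "?t \<in> Hom (functor_category C D) F ?Z" by (simp add: Hom_def fc_sel)
      fix s assume "s \<in> Hom (functor_category C D) F ?Z"
      then have s: "is_nat_trans C D s" "Src s = F" "Tgt s = ?Z" by (auto simp: Hom_def fc_sel)
      show "s = ?t"
      proof (rule nt_eqI[OF s(1) \<open>is_nat_trans C D ?t\<close>])
        fix a assume a: "a \<in> Obj C"
        then have "Cpt s a \<in> Hom D (FObj F a) z" using s by (auto simp: is_nat_trans_def)
        then show "Cpt s a = Cpt ?t a" using a u(1)[OF FO] p FO by simp
      qed (use s in auto)
    qed
    show "\<exists>!f. f \<in> Hom (functor_category C D) ?Z F"
    proof (rule ex1I)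
      let ?t = "\<lparr>Src = ?Z, Tgt = F, Cpt = \<lambda>a\<in>Obj C. q (FObj F a)\<rparr>"
      have "is_nat_trans C D ?t" unfolding is_nat_trans_def using F Z FO q
        by (auto simp: idA intro!: u(2)[OF FO] D.Comp_Hom[OF z(2)] D.Comp_Hom[OF _ FA])
      then show "?t \<in> Hom (functor_category C D) ?Z F" by (simp add: Hom_def fc_sel)
      fix s assume "s \<in> Hom (functor_category C D) ?Z F"
      then have s: "is_nat_trans C D s" "Tgt s = F" "Src s = ?Z" by (auto simp: Hom_def fc_sel)
      show "s = ?t"
      proof (rule nt_eqI[OF s(1) \<open>is_nat_trans C D ?t\<close>])
        fix a assume a: "a \<in> Obj C"
        then have "Cpt s a \<in> Hom D z (FObj F a)" using s by (auto simp: is_nat_trans_def)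
        then show "Cpt s a = Cpt ?t a" using a u(2)[OF FO] q FO by simp
      qed (use s in auto)
    qed
  qed
qed

lemma zero_arrow_fc:
  assumes "category C" "category D" "zero_object D z" "is_nat_trans C D t"
  shows "zero_arrow (functor_category C D) t \<longleftrightarrow> (\<forall>a \<in> Obj C. zero_arrow D (Cpt t a))"
proof -
  interpret C: category C by fact
  interpret D: category D by fact
  let ?F = "functor_category C D"
  interpret F: category ?F using category_fc[OF assms(1,2)] .
  let ?Z = "\<lparr>FObj = \<lambda>a\<in>Obj C. z, FArr = \<lambda>f\<in>Arr C. Id D z\<rparr>"
  note Z = zero_functor[OF assms(1-3)]
  have st: "Src t \<in> Obj ?F" "Tgt t \<in> Obj ?F" and t: "t \<in> Hom ?F (Src t) (Tgt t)"
    using assms(4) by (auto simp: is_nat_trans_def fc_sel Hom_def)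
  obtain p q where p: "p \<in> Hom ?F (Src t) ?Z" and q: "q \<in> Hom ?F ?Z (Tgt t)"
    using zero_objectD(1)[OF Z st(1)] zero_objectD(2)[OF Z st(2)] by blast
  have pc: "Cpt p a \<in> Hom D (FObj (Src t) a) z" and qc: "Cpt q a \<in> Hom D z (FObj (Tgt t) a)"
    and tc: "Cpt t a \<in> Hom D (FObj (Src t) a) (FObj (Tgt t) a)"
    if "a \<in> Obj C" for a using p q that assms(4) by (auto simp: Hom_def[of ?F] fc_sel is_nat_trans_def)
  have "zero_arrow ?F t \<longleftrightarrow> t = q \<odot>\<^bsub>?F\<^esub> p"
    using F.zero_arrow_through[OF _ t Z p q] Z p q t HomD unfolding zero_arrow_def
    by metis
  also have "\<dots> \<longleftrightarrow> (\<forall>a \<in> Obj C. Cpt t a = Cpt q a \<odot>\<^bsub>D\<^esub> Cpt p a)"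
  proof
    assume "t = q \<odot>\<^bsub>?F\<^esub> p"
    then have "Cpt t = (\<lambda>a \<in> Obj C. Cpt q a \<odot>\<^bsub>D\<^esub> Cpt p a)" by (simp add: fc_sel)
    then show "\<forall>a \<in> Obj C. Cpt t a = Cpt q a \<odot>\<^bsub>D\<^esub> Cpt p a" by simp
  next
    assume a: "\<forall>a \<in> Obj C. Cpt t a = Cpt q a \<odot>\<^bsub>D\<^esub> Cpt p a"
    have h: "q \<odot>\<^bsub>?F\<^esub> p \<in> Hom ?F (Src t) (Tgt t)" using F.Comp_Hom p q by blast
    show "t = q \<odot>\<^bsub>?F\<^esub> p"
      using a h by (intro nt_eqI[OF assms(4)]) (auto simp: Hom_def[of ?F] fc_sel)
  qed
  also have "\<dots> \<longleftrightarrow> (\<forall>a \<in> Obj C. zero_arrow D (Cpt t a))"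
  proof (rule ball_cong[OF refl])
    fix a assume a: "a \<in> Obj C"
    show "Cpt t a = Cpt q a \<odot>\<^bsub>D\<^esub> Cpt p a \<longleftrightarrow> zero_arrow D (Cpt t a)"
      using D.zero_arrow_through[OF _ tc[OF a] assms(3) pc[OF a] qc[OF a]] assms(3) pc[OF a] qc[OF a] tc[OF a] HomD
      unfolding zero_arrow_def by metis
  qed
  finally show ?thesis .
qed

lemma ex_cokernel_fc:
  assumes "category C" "abelian_category D" "is_nat_trans C D t"
  shows "\<exists>c. is_cokernel (functor_category C D) c t"
proof -
  interpret C: category C by fact
  interpret D: abelian_category D by fact
  have D: "category D" by unfold_locales
  let ?F = "functor_category C D"
  interpret F: category ?F using category_fc[OF assms(1) D] .
  obtain z where z: "zero_object D z" using D.ex_zero_object by blast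
  let ?S = "Src t" and ?T = "Tgt t"
  have fS: "is_functor C D ?S" and fT: "is_functor C D ?T" using assms by (auto simp: is_nat_trans_def)
  have tc: "Cpt t a \<in> Hom D (FObj ?S a) (FObj ?T a)" if "a \<in> Obj C" for a
    using that assms by (auto simp: is_nat_trans_def)
  have nat: "FArr ?T f \<odot>\<^bsub>D\<^esub> Cpt t (Dom C f) = Cpt t (Cod C f) \<odot>\<^bsub>D\<^esub> FArr ?S f" if "f \<in> Arr C" for f
    using that assms by (auto simp: is_nat_trans_def)
  have TA: "FArr ?T f \<in> Hom D (FObj ?T (Dom C f)) (FObj ?T (Cod C f))"
    and SA: "FArr ?S f \<in> Hom D (FObj ?S (Dom C f)) (FObj ?S (Cod C f))" if "f \<in> Arr C" for f
    using that fS fT by (auto simp: is_functor_def)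
  define c where "c = (\<lambda>a. SOME k. is_cokernel D k (Cpt t a))"
  have ck: "is_cokernel D (c a) (Cpt t a)" if "a \<in> Obj C" for a
    unfolding c_def using D.ex_cokernel tc[OF that] HomD by (metis someI_ex)
  define K where "K = (\<lambda>a. Cod D (c a))"
  have c: "c a \<in> Hom D (FObj ?T a) (K a)" if "a \<in> Obj C" for a
    using ck[OF that] tc[OF that] by (auto simp: is_cokernel_def Hom_def K_def)
  have KO: "K a \<in> Obj D" if "a \<in> Obj C" for a using c[OF that] D.Cod_Obj[of "c a"] by (simp add: Hom_def)
  have cz: "zero_arrow D (c a \<odot>\<^bsub>D\<^esub> Cpt t a)" if "a \<in> Obj C" for a
    using ck[OF that] by (simp add: is_cokernel_def)
  have fact: "\<exists>!u. u \<in> Hom D (K a) x \<and> u \<odot>\<^bsub>D\<^esub> c a = g"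
    if "a \<in> Obj C" "g \<in> Hom D (FObj ?T a) x" "zero_arrow D (g \<odot>\<^bsub>D\<^esub> Cpt t a)" for a g x
  proof -
    have "Cod D (Cpt t a) = FObj ?T a" using tc[OF that(1)] by (simp add: Hom_def)
    then have "\<forall>x. \<forall>g\<in>Hom D (FObj ?T a) x. zero_arrow D (g \<odot>\<^bsub>D\<^esub> Cpt t a) \<longrightarrow>
        (\<exists>!u. u \<in> Hom D (K a) x \<and> u \<odot>\<^bsub>D\<^esub> c a = g)"
      using ck[OF that(1)] unfolding is_cokernel_def K_def by simp
    then show ?thesis using that(2,3) by blast
  qed
  have canc: "u = v" if "a \<in> Obj C" "u \<in> Hom D (K a) x" "v \<in> Hom D (K a) x"
      "u \<odot>\<^bsub>D\<^esub> c a = v \<odot>\<^bsub>D\<^esub> c a" for a u v x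
  proof -
    have "\<forall>x. \<forall>f\<in>Hom D (K a) x. \<forall>g\<in>Hom D (K a) x. f \<odot>\<^bsub>D\<^esub> c a = g \<odot>\<^bsub>D\<^esub> c a \<longrightarrow> f = g"
      using D.cokernel_epic[OF ck[OF that(1)]] unfolding epic_def K_def by simp
    then show ?thesis using that(2-4) by simp
  qed
  define KA where "KA = (\<lambda>f. THE u. u \<in> Hom D (K (Dom C f)) (K (Cod C f)) \<and>
      u \<odot>\<^bsub>D\<^esub> c (Dom C f) = c (Cod C f) \<odot>\<^bsub>D\<^esub> FArr ?T f)"
  have KA: "KA f \<in> Hom D (K (Dom C f)) (K (Cod C f)) \<and>
      KA f \<odot>\<^bsub>D\<^esub> c (Dom C f) = c (Cod C f) \<odot>\<^bsub>D\<^esub> FArr ?T f" if f: "f \<in> Arr C" for f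
  proof -
    have a: "Dom C f \<in> Obj C" "Cod C f \<in> Obj C" using f C.Dom_Obj C.Cod_Obj by auto
    have "zero_arrow D ((c (Cod C f) \<odot>\<^bsub>D\<^esub> Cpt t (Cod C f)) \<odot>\<^bsub>D\<^esub> FArr ?S f)"
      by (rule D.zero_arrow_pre[OF cz D.Comp_Hom[OF tc c] SA]) (use a f in auto)
    then have "zero_arrow D ((c (Cod C f) \<odot>\<^bsub>D\<^esub> FArr ?T f) \<odot>\<^bsub>D\<^esub> Cpt t (Dom C f))"
      using nat[OF f] D.Comp_assoc[OF SA[OF f] tc[OF a(2)] c[OF a(2)]]
        D.Comp_assoc[OF tc[OF a(1)] TA[OF f] c[OF a(2)]] by simp
    from theI'[OF fact[OF a(1) D.Comp_Hom[OF TA[OF f] c[OF a(2)]] this]] show ?thesis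
      unfolding KA_def .
  qed
  let ?K = "\<lparr>FObj = \<lambda>a\<in>Obj C. K a, FArr = \<lambda>f\<in>Arr C. KA f\<rparr>"
  have ida: "KA (Id C a) = Id D (K a)" if a: "a \<in> Obj C" for a
  proof -
    have i: "Id C a \<in> Arr C" "Dom C (Id C a) = a" "Cod C (Id C a) = a" using C.Id_Hom[OF a] by (auto simp: Hom_def)
    have "FArr ?T (Id C a) = Id D (FObj ?T a)" using fT a by (auto simp: is_functor_def)
    have k: "KA (Id C a) \<in> Hom D (K a) (K a)" using KA[OF i(1)] unfolding i(2,3) by simp
    have "KA (Id C a) \<odot>\<^bsub>D\<^esub> c a = c a \<odot>\<^bsub>D\<^esub> FArr ?T (Id C a)"
      using KA[OF i(1)] unfolding i(2,3) by simp
    also have "\<dots> = Id D (K a) \<odot>\<^bsub>D\<^esub> c a"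
      using \<open>FArr ?T (Id C a) = _\<close> D.Id_Comp[OF c[OF a]] D.Comp_Id[OF c[OF a]] by simp
    finally show ?thesis by (rule canc[OF a k D.Id_Hom[OF KO[OF a]]])
  qed
  have compa: "KA (g \<odot>\<^bsub>C\<^esub> f) = KA g \<odot>\<^bsub>D\<^esub> KA f" if f: "f \<in> Arr C" and g: "g \<in> Arr C" and e: "Dom C g = Cod C f" for f g
  proof -
    have gf: "g \<odot>\<^bsub>C\<^esub> f \<in> Arr C" "Dom C (g \<odot>\<^bsub>C\<^esub> f) = Dom C f" "Cod C (g \<odot>\<^bsub>C\<^esub> f) = Cod C g"
      using C.Comp_Hom'[OF f g e] by (auto simp: Hom_def)
    have o: "Dom C f \<in> Obj C" "Cod C f \<in> Obj C" "Cod C g \<in> Obj C" using f g C.Dom_Obj C.Cod_Obj by auto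
    have k: "KA f \<in> Hom D (K (Dom C f)) (K (Cod C f))" "KA g \<in> Hom D (K (Cod C f)) (K (Cod C g))"
      "KA f \<odot>\<^bsub>D\<^esub> c (Dom C f) = c (Cod C f) \<odot>\<^bsub>D\<^esub> FArr ?T f"
      "KA g \<odot>\<^bsub>D\<^esub> c (Cod C f) = c (Cod C g) \<odot>\<^bsub>D\<^esub> FArr ?T g"
      using KA[OF f] KA[OF g] e by auto
    have T: "FArr ?T (g \<odot>\<^bsub>C\<^esub> f) = FArr ?T g \<odot>\<^bsub>D\<^esub> FArr ?T f" using fT f g e by (auto simp: is_functor_def)
    have Tg: "FArr ?T g \<in> Hom D (FObj ?T (Cod C f)) (FObj ?T (Cod C g))" using TA[OF g] e by simp
    have "(KA g \<odot>\<^bsub>D\<^esub> KA f) \<odot>\<^bsub>D\<^esub> c (Dom C f) = KA g \<odot>\<^bsub>D\<^esub> (c (Cod C f) \<odot>\<^bsub>D\<^esub> FArr ?T f)"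
      using D.Comp_assoc[OF c[OF o(1)] k(1,2)] k(3) by simp
    also have "\<dots> = (c (Cod C g) \<odot>\<^bsub>D\<^esub> FArr ?T g) \<odot>\<^bsub>D\<^esub> FArr ?T f"
      using D.Comp_assoc[OF TA[OF f] c[OF o(2)] k(2)] k(4) by simp
    also have "\<dots> = KA (g \<odot>\<^bsub>C\<^esub> f) \<odot>\<^bsub>D\<^esub> c (Dom C f)"
      using D.Comp_assoc[OF TA[OF f] Tg c[OF o(3)]] KA[OF gf(1)] gf T by simp
    finally show ?thesis using canc[OF o(1) _ D.Comp_Hom[OF k(1,2)]] KA[OF gf(1)] gf by simp
  qed
  have fK: "is_functor C D ?K" unfolding is_functor_def
    using KO KA ida compa C.Dom_Obj C.Cod_Obj C.Id_Hom C.Comp_Hom' by (auto simp: Hom_def)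
  let ?c = "\<lparr>Src = ?T, Tgt = ?K, Cpt = \<lambda>a\<in>Obj C. c a\<rparr>"
  have nc: "is_nat_trans C D ?c" unfolding is_nat_trans_def using fT fK c KA C.Dom_Obj C.Cod_Obj by auto
  have "is_cokernel ?F ?c t" unfolding is_cokernel_def
  proof (intro conjI allI ballI impI)
    show "t \<in> Arr ?F" "?c \<in> Arr ?F" "Dom ?F ?c = Cod ?F t" using assms nc by (auto simp: fc_sel)
    have "is_nat_trans C D (?c \<odot>\<^bsub>?F\<^esub> t)" using Comp_nt[OF assms(1) D assms(3) nc] by (simp add: fc_sel)
    then show "zero_arrow ?F (?c \<odot>\<^bsub>?F\<^esub> t)"
      using zero_arrow_fc[OF assms(1) D z] cz by (simp add: fc_sel)
    fix G g assume g0: "g \<in> Hom ?F (Cod ?F t) G" and gz: "zero_arrow ?F (g \<odot>\<^bsub>?F\<^esub> t)"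
    then have g: "is_nat_trans C D g" "Src g = ?T" "Tgt g = G" by (auto simp: Hom_def fc_sel)
    have fG: "is_functor C D G" using g by (auto simp: is_nat_trans_def)
    have GA: "FArr G f \<in> Hom D (FObj G (Dom C f)) (FObj G (Cod C f))" if "f \<in> Arr C" for f
      using that fG by (auto simp: is_functor_def)
    have gc: "Cpt g a \<in> Hom D (FObj ?T a) (FObj G a)" if "a \<in> Obj C" for a
      using that g by (auto simp: is_nat_trans_def)
    have "is_nat_trans C D (g \<odot>\<^bsub>?F\<^esub> t)" using Comp_nt[OF assms(1) D assms(3) g(1)] g by (simp add: fc_sel)
    then have gz': "zero_arrow D (Cpt g a \<odot>\<^bsub>D\<^esub> Cpt t a)" if "a \<in> Obj C" for a
      using zero_arrow_fc[OF assms(1) D z] gz that by (auto simp: fc_sel)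
    define u where "u = (\<lambda>a. THE u. u \<in> Hom D (K a) (FObj G a) \<and> u \<odot>\<^bsub>D\<^esub> c a = Cpt g a)"
    have u: "u a \<in> Hom D (K a) (FObj G a)" "u a \<odot>\<^bsub>D\<^esub> c a = Cpt g a" if "a \<in> Obj C" for a
      using theI'[OF fact[OF that gc[OF that] gz'[OF that]]] unfolding u_def by auto
    have un: "FArr G f \<odot>\<^bsub>D\<^esub> u (Dom C f) = u (Cod C f) \<odot>\<^bsub>D\<^esub> KA f" if f: "f \<in> Arr C" for f
    proof -
      have o: "Dom C f \<in> Obj C" "Cod C f \<in> Obj C" using f C.Dom_Obj C.Cod_Obj by auto
      have k: "KA f \<in> Hom D (K (Dom C f)) (K (Cod C f))"
        "KA f \<odot>\<^bsub>D\<^esub> c (Dom C f) = c (Cod C f) \<odot>\<^bsub>D\<^esub> FArr ?T f" using KA[OF f] by auto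
      have "(FArr G f \<odot>\<^bsub>D\<^esub> u (Dom C f)) \<odot>\<^bsub>D\<^esub> c (Dom C f) = FArr G f \<odot>\<^bsub>D\<^esub> Cpt g (Dom C f)"
        using D.Comp_assoc[OF c[OF o(1)] u(1)[OF o(1)] GA[OF f]] u(2)[OF o(1)] by simp
      also have "\<dots> = Cpt g (Cod C f) \<odot>\<^bsub>D\<^esub> FArr ?T f" using g f by (auto simp: is_nat_trans_def)
      also have "\<dots> = u (Cod C f) \<odot>\<^bsub>D\<^esub> (c (Cod C f) \<odot>\<^bsub>D\<^esub> FArr ?T f)"
        using D.Comp_assoc[OF TA[OF f] c[OF o(2)] u(1)[OF o(2)]] u(2)[OF o(2)] by simp
      also have "\<dots> = (u (Cod C f) \<odot>\<^bsub>D\<^esub> KA f) \<odot>\<^bsub>D\<^esub> c (Dom C f)"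
        using D.Comp_assoc[OF c[OF o(1)] k(1) u(1)[OF o(2)]] k(2) by simp
      finally show ?thesis
        using canc[OF o(1) D.Comp_Hom[OF u(1)[OF o(1)] GA[OF f]] D.Comp_Hom[OF k(1) u(1)[OF o(2)]]] by simp
    qed
    show "\<exists>!v. v \<in> Hom ?F (Cod ?F ?c) G \<and> v \<odot>\<^bsub>?F\<^esub> ?c = g"
    proof (rule ex1I)
      let ?u = "\<lparr>Src = ?K, Tgt = G, Cpt = \<lambda>a\<in>Obj C. u a\<rparr>"
      have nu: "is_nat_trans C D ?u" unfolding is_nat_trans_def using fG fK u un C.Dom_Obj C.Cod_Obj by auto
      have "?u \<odot>\<^bsub>?F\<^esub> ?c = g"
      proof (rule nt_eqI[OF _ g(1)])
        show "is_nat_trans C D (?u \<odot>\<^bsub>?F\<^esub> ?c)" using Comp_nt[OF assms(1) D nc nu] by (simp add: fc_sel)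
      qed (use g u in \<open>auto simp: fc_sel\<close>)
      then show "?u \<in> Hom ?F (Cod ?F ?c) G \<and> ?u \<odot>\<^bsub>?F\<^esub> ?c = g" using nu by (simp add: Hom_def fc_sel)
      fix v assume v: "v \<in> Hom ?F (Cod ?F ?c) G \<and> v \<odot>\<^bsub>?F\<^esub> ?c = g"
      then have vn: "is_nat_trans C D v" "Src v = ?K" "Tgt v = G" by (auto simp: Hom_def fc_sel)
      show "v = ?u"
      proof (rule nt_eqI[OF vn(1) nu])
        fix a assume a: "a \<in> Obj C"
        have "Cpt v a \<odot>\<^bsub>D\<^esub> c a = Cpt (v \<odot>\<^bsub>?F\<^esub> ?c) a" using a by (simp add: fc_sel)
        also have "\<dots> = u a \<odot>\<^bsub>D\<^esub> c a" using v u a by simp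
        finally have e: "Cpt v a \<odot>\<^bsub>D\<^esub> c a = u a \<odot>\<^bsub>D\<^esub> c a" .
        have "Cpt v a \<in> Hom D (FObj (Src v) a) (FObj (Tgt v) a)" using vn(1) a by (simp add: is_nat_trans_def)
        then have "Cpt v a \<in> Hom D (K a) (FObj G a)" using vn(2,3) a by simp
        then have "Cpt v a = u a" by (rule canc[OF a _ u(1)[OF a] e])
        then show "Cpt v a = Cpt ?u a" using a by simp
      qed (use vn in auto)
    qed
  qed
  then show ?thesis by blast
qed

theorem pr_dual_in_Pr:
  assumes "abelian_category C" "\<tau> \<in> Pr C"
  shows "pr_dual C \<tau> \<in> Pr (op_cat C)"
proof -
  interpret C: abelian_category C by fact
  have C: "category C" by unfold_locales
  let ?F = "functor_category C C" and ?G = "functor_category (op_cat C) (op_cat C)"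
  let ?I = "id_functor C"
  interpret F: category ?F using category_fc[OF C C] .
  obtain t where t: "t \<in> monics_into ?F ?I" "\<tau> = sub_equiv ?F ?I `` {t}"
    using assms(2) by (auto simp: Pr_def subobjects_def quotient_def)
  have ta: "t \<in> Arr ?F" "Cod ?F t = ?I" using t(1) by (auto simp: monics_into_def monic_def)
  have "factors_through ?F t t" using F.Comp_Id[OF HomI[OF ta(1)]] F.Id_Hom[OF F.Dom_Obj[OF ta(1)]]
    by (auto simp: factors_through_def)
  then have tt: "t \<in> \<tau>" using t by (auto simp: sub_equiv_def)
  obtain c where c: "is_cokernel ?F c t" using ex_cokernel_fc[OF C assms(1)] ta by (auto simp: fc_sel)
  have eq: "s \<in> monics_into ?F ?I \<and> factors_through ?F t s \<and> factors_through ?F s t" if "s \<in> \<tau>" for s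
    using that t by (auto simp: sub_equiv_def)
  have mon: "op_nat_trans d \<in> monics_into ?G ?I" if "is_cokernel ?F d s" "s \<in> \<tau>" for d s
  proof -
    have "monic ?G (op_nat_trans d)" using monic_op F.cokernel_epic that by blast
    moreover have "Dom ?F d = ?I" using that eq by (auto simp: is_cokernel_def monics_into_def)
    ultimately show ?thesis by (simp add: monics_into_def fc_sel op_nt_sel)
  qed
  have fo: "factors_through ?G (op_nat_trans d) (op_nat_trans e)"
    if de: "is_cokernel ?F d s" "s \<in> \<tau>" "is_cokernel ?F e r" "r \<in> \<tau>" for d s e r
  proof -
    have tr: "factors_through ?F r s"
    proof -
      obtain u where u: "u \<in> Hom ?F (Dom ?F r) (Dom ?F t)" "t \<odot>\<^bsub>?F\<^esub> u = r" using eq[OF de(4)] by (auto simp: factors_through_def)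
      obtain v where v: "v \<in> Hom ?F (Dom ?F t) (Dom ?F s)" "s \<odot>\<^bsub>?F\<^esub> v = t" using eq[OF de(2)] by (auto simp: factors_through_def)
      have "s \<odot>\<^bsub>?F\<^esub> (v \<odot>\<^bsub>?F\<^esub> u) = r"
        using F.Comp_assoc[OF u(1) v(1) HomI[of s]] u v de by (auto simp: is_cokernel_def)
      then show ?thesis using F.Comp_Hom[OF u(1) v(1)] by (auto simp: factors_through_def)
    qed
    have cd: "Cod ?F r = Cod ?F s" using eq de by (auto simp: monics_into_def)
    obtain w where w: "w \<in> Hom ?F (Cod ?F e) (Cod ?F d)" "w \<odot>\<^bsub>?F\<^esub> e = d"
      using F.cokernels_factor[OF de(3,1) tr cd] by blast
    then have "op_nat_trans w \<in> Hom ?G (Dom ?G (op_nat_trans d)) (Dom ?G (op_nat_trans e))"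
      by (simp add: Hom_op fc_sel op_nt_sel)
    moreover have "op_nat_trans e \<odot>\<^bsub>?G\<^esub> op_nat_trans w = op_nat_trans d" using w by (simp add: comp_op)
    ultimately show ?thesis by (auto simp: factors_through_def)
  qed
  have "pr_class (op_cat C) (op_nat_trans d) = pr_class (op_cat C) (op_nat_trans c)"
    if ds: "is_cokernel ?F d s" "s \<in> \<tau>" for d s
  proof -
    have tra: "factors_through ?G x z"
      if xyz: "factors_through ?G x y" "factors_through ?G y z" "z \<in> Arr ?G" for x y z
    proof -
      interpret G: category ?G using category_fc[OF category_op[OF C] category_op[OF C]] .
      obtain u where u: "u \<in> Hom ?G (Dom ?G x) (Dom ?G y)" "y \<odot>\<^bsub>?G\<^esub> u = x" using xyz unfolding factors_through_def by blast
      obtain v where v: "v \<in> Hom ?G (Dom ?G y) (Dom ?G z)" "z \<odot>\<^bsub>?G\<^esub> v = y" using xyz unfolding factors_through_def by blast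
      have "z \<odot>\<^bsub>?G\<^esub> (v \<odot>\<^bsub>?G\<^esub> u) = x"
        using G.Comp_assoc[OF u(1) v(1) HomI[OF xyz(3)]] u v by auto
      then show ?thesis using G.Comp_Hom[OF u(1) v(1)] by (auto simp: factors_through_def)
    qed
    have da: "op_nat_trans d \<in> Arr ?G" "op_nat_trans c \<in> Arr ?G"
      using mon[OF ds] mon[OF c tt] by (auto simp: monics_into_def monic_def)
    have "(factors_through ?G (op_nat_trans d) y \<and> factors_through ?G y (op_nat_trans d)) \<longleftrightarrow>
        (factors_through ?G (op_nat_trans c) y \<and> factors_through ?G y (op_nat_trans c))"
      (is "?l \<longleftrightarrow> ?r") if "y \<in> Arr ?G" for y
    proof
      assume ?l then show ?r using tra[OF fo[OF c tt ds] _ that] tra[OF _ fo[OF ds c tt] da(2)] by simp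
    next
      assume ?r then show ?l using tra[OF fo[OF ds c tt] _ that] tra[OF _ fo[OF c tt ds] da(1)] by simp
    qed
    moreover have "y \<in> Arr ?G" if "y \<in> monics_into ?G ?I" for y
      using that by (simp add: monics_into_def monic_def)
    ultimately have "((op_nat_trans d, y) \<in> sub_equiv ?G ?I) = ((op_nat_trans c, y) \<in> sub_equiv ?G ?I)" for y
      using mon[OF ds] mon[OF c tt] unfolding sub_equiv_def mem_Collect_eq prod.case by meson
    then show ?thesis unfolding pr_class_def id_functor_op by blast
  qed
  then have "{pr_class (op_cat C) (op_nat_trans c) | t c. t \<in> \<tau> \<and> is_cokernel ?F c t}
      = {pr_class (op_cat C) (op_nat_trans c)}"
    using c tt by blast
  then have "pr_dual C \<tau> = pr_class (op_cat C) (op_nat_trans c)"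
    unfolding pr_dual_def by simp
  then show ?thesis using mon[OF c tt]
    by (simp add: Pr_def subobjects_def id_functor_op pr_class_def quotientI)
qed

end

(* Let t : T -> 1 represent tau, with cokernel c : 1 -> T*. Both properties are componentwise:
   tau is idempotent iff every component t_{T a} is invertible, and tau is a radical iff every
   t_{T* a} vanishes, i.e. iff every c_{T* a} is invertible. For the latter, the pullback p of
   m = tT* along c is the kernel of ec, where e is a cokernel of m; if p is equivalent to t, then
   ec and c are cokernels of the same arrow, so e is a split monic and m = 0. As c^op represents
   the dual of tau and has cokernel t^op, the two criteria are exchanged by duality. They need
   kernels in the functor category to be componentwise, which is shown by constructing
   subfunctors from families of monics. *)

theory Submission
  imports Defs
begin

section \<open>Zero arrows, kernels and invertible arrows\<close>

text \<open>The product is a composite of whiskered monics, the coproduct is a pullback, and the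
  dual of a pullback is a pushout. The operations themselves are therefore never dualised: both
  equations are reduced to conditions on components, and components are unchanged when read in the
  opposite category.

  \<open>pr_product\<close> and \<open>pr_coproduct\<close> are unions of classes over all
  representatives, cokernels and pullbacks, so an equation with \<open>\<tau>\<close> yields only
  that some single choice lies in \<open>\<tau>\<close>. Naturality along isomorphisms then carries
  the condition from that choice to the fixed representative; this takes the place of showing
  separately that the operations are well defined.

  Componentwise kernels serve two facts that are not formal: whiskering keeps \<open>t\<close>
  monic, and a monic transformation is the kernel of its cokernel. The second is used in the
  pullback argument and again to see that \<open>t\<close>, read in the opposite category, is a
  cokernel of the dual.\<close>

definition invertible :: "('o, 'm) cat \<Rightarrow> 'm \<Rightarrow> bool" where
  "invertible C f \<longleftrightarrow> f \<in> Arr C \<and>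
     (\<exists>g \<in> Hom C (Cod C f) (Dom C f). g \<odot>\<^bsub>C\<^esub> f = Id C (Dom C f) \<and> f \<odot>\<^bsub>C\<^esub> g = Id C (Cod C f))"

lemma monicD:
  assumes "monic C m" "m \<in> Hom C a b" "f \<in> Hom C x a" "g \<in> Hom C x a" "m \<odot>\<^bsub>C\<^esub> f = m \<odot>\<^bsub>C\<^esub> g"
  shows "f = g"
  using assms unfolding monic_def Hom_def by auto

lemma epicD:
  assumes "epic C e" "e \<in> Hom C a b" "f \<in> Hom C b x" "g \<in> Hom C b x" "f \<odot>\<^bsub>C\<^esub> e = g \<odot>\<^bsub>C\<^esub> e"
  shows "f = g"
  using assms unfolding epic_def Hom_def by auto

lemma invertibleE:
  assumes "invertible C f" "f \<in> Hom C a b"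
  obtains g where "g \<in> Hom C b a" "g \<odot>\<^bsub>C\<^esub> f = Id C a" "f \<odot>\<^bsub>C\<^esub> g = Id C b"
  using assms by (auto simp: invertible_def Hom_def)

lemma invertibleI:
  assumes "f \<in> Hom C a b" "g \<in> Hom C b a" "g \<odot>\<^bsub>C\<^esub> f = Id C a" "f \<odot>\<^bsub>C\<^esub> g = Id C b"
  shows "invertible C f"
  using assms by (auto simp: invertible_def Hom_def)

lemma is_kernelD:
  assumes "is_kernel C k f"
  shows "f \<in> Hom C (Dom C f) (Cod C f)" "k \<in> Hom C (Dom C k) (Dom C f)" "zero_arrow C (f \<odot>\<^bsub>C\<^esub> k)"
    "\<lbrakk>g \<in> Hom C x (Dom C f); zero_arrow C (f \<odot>\<^bsub>C\<^esub> g)\<rbrakk> \<Longrightarrow> \<exists>u \<in> Hom C x (Dom C k). k \<odot>\<^bsub>C\<^esub> u = g"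
  using assms unfolding is_kernel_def Hom_def by blast+

text \<open>Monicity of \<open>k\<close> supplies the uniqueness in the universal property, so only
  existence of factorisations remains to be shown.\<close>

lemma is_kernelI:
  assumes "f \<in> Hom C a b" "k \<in> Hom C c a" "zero_arrow C (f \<odot>\<^bsub>C\<^esub> k)" "monic C k"
    "\<And>x g. \<lbrakk>g \<in> Hom C x a; zero_arrow C (f \<odot>\<^bsub>C\<^esub> g)\<rbrakk> \<Longrightarrow> \<exists>u \<in> Hom C x c. k \<odot>\<^bsub>C\<^esub> u = g"
  shows "is_kernel C k f"
proof -
  have "\<exists>!u. u \<in> Hom C x c \<and> k \<odot>\<^bsub>C\<^esub> u = g" if "g \<in> Hom C x a" "zero_arrow C (f \<odot>\<^bsub>C\<^esub> g)" for x g
    using assms(5)[OF that] monicD[OF assms(4,2)] by metis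
  then show ?thesis using HomD[OF assms(1)] HomD[OF assms(2)] assms(3) by (simp add: is_kernel_def)
qed

lemma is_cokernelD:
  assumes "is_cokernel C c f"
  shows "f \<in> Hom C (Dom C f) (Cod C f)" "c \<in> Hom C (Cod C f) (Cod C c)" "zero_arrow C (c \<odot>\<^bsub>C\<^esub> f)"
    "\<lbrakk>g \<in> Hom C (Cod C f) x; zero_arrow C (g \<odot>\<^bsub>C\<^esub> f)\<rbrakk> \<Longrightarrow> \<exists>u \<in> Hom C (Cod C c) x. u \<odot>\<^bsub>C\<^esub> c = g"
  using assms unfolding is_cokernel_def Hom_def by blast+

context category
begin

lemma Hom_Obj:
  assumes "f \<in> Hom C a b"
  shows "a \<in> Obj C" "b \<in> Obj C"
  using assms Dom_Obj Cod_Obj by (auto simp: Hom_def)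

lemma zero_arrow_unique:
  assumes "zero_arrow C f" "zero_arrow C g" "f \<in> Hom C a b" "g \<in> Hom C a b"
  shows "f = g"
proof -
  obtain z p q where "zero_object C z" "p \<in> Hom C a z" "q \<in> Hom C z b" "f = q \<odot> p"
    using assms(1,3) HomD unfolding zero_arrow_def by metis
  then show ?thesis using zero_arrow_through[OF assms(2,4)] by simp
qed

lemma ex_zero_arrow:
  assumes "zero_object C z" "a \<in> Obj C" "b \<in> Obj C"
  shows "\<exists>f \<in> Hom C a b. zero_arrow C f"
proof -
  obtain p q where "p \<in> Hom C a z" "q \<in> Hom C z b"
    using zero_objectD(1)[OF assms(1,2)] zero_objectD(2)[OF assms(1,3)] by blast
  moreover from this have "q \<odot> p \<in> Hom C a b" by (rule Comp_Hom)
  ultimately show ?thesis using assms(1) by (auto simp: zero_arrow_def Hom_def)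
qed

lemma monic_reflects_zero:
  assumes "monic C m" "m \<in> Hom C a b" "f \<in> Hom C x a" "zero_arrow C (m \<odot> f)"
  shows "zero_arrow C f"
proof -
  \<comment> \<open>A bare \<open>category\<close> need not have a zero object; one is taken from
    the factorisation of \<open>m \<odot> f\<close>. The zero arrow \<open>g\<close> built from it
    is then compared with \<open>f\<close> under \<open>m\<close>.\<close>
  obtain z where "zero_object C z" using assms(4) by (auto simp: zero_arrow_def)
  then obtain g where g: "g \<in> Hom C x a" "zero_arrow C g"
    using ex_zero_arrow Hom_Obj[OF assms(3)] by metis
  have "m \<odot> f = m \<odot> g"
    using zero_arrow_unique[OF assms(4) zero_arrow_post[OF g(2,1) assms(2)]] Comp_Hom assms(2,3) g(1)
    by blast
  with monicD[OF assms(1-3) g(1)] g(2) show ?thesis by simp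
qed

section \<open>Monic, epic and invertible arrows\<close>

lemma monic_left_invertible:
  assumes "f \<in> Hom C a b" "g \<in> Hom C b a" "g \<odot> f = Id C a"
  shows "monic C f"
  unfolding monic_def
proof (intro conjI allI ballI impI)
  show "f \<in> Arr C" using assms(1) by (simp add: Hom_def)
  fix x h k assume *: "h \<in> Hom C x (Dom C f)" "k \<in> Hom C x (Dom C f)" "f \<odot> h = f \<odot> k"
  then have **: "h \<in> Hom C x a" "k \<in> Hom C x a" using assms(1) by (auto simp: Hom_def)
  then have "Id C a \<odot> h = Id C a \<odot> k"
    using Comp_assoc[OF _ assms(1,2)] assms(3) *(3) by metis
  then show "h = k" using Id_Comp ** by metis
qed

lemma monic_comp:
  assumes "monic C f" "monic C g" "f \<in> Hom C a b" "g \<in> Hom C b c"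
  shows "monic C (g \<odot> f)"
  unfolding monic_def
proof (intro conjI allI ballI impI)
  have gf: "g \<odot> f \<in> Hom C a c" using Comp_Hom assms by blast
  then show "g \<odot> f \<in> Arr C" by (simp add: Hom_def)
  fix x h k assume *: "h \<in> Hom C x (Dom C (g \<odot> f))" "k \<in> Hom C x (Dom C (g \<odot> f))"
    "(g \<odot> f) \<odot> h = (g \<odot> f) \<odot> k"
  then have **: "h \<in> Hom C x a" "k \<in> Hom C x a" using gf by (auto simp: Hom_def)
  then have "g \<odot> (f \<odot> h) = g \<odot> (f \<odot> k)" using Comp_assoc[OF _ assms(3,4)] * by metis
  then have "f \<odot> h = f \<odot> k" using monicD[OF assms(2,4)] Comp_Hom[OF _ assms(3)] ** by blast
  then show "h = k" using monicD[OF assms(1,3)] ** by blast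
qed

lemma epic_comp:
  assumes "epic C f" "epic C g" "f \<in> Hom C a b" "g \<in> Hom C b c"
  shows "epic C (g \<odot> f)"
  unfolding epic_def
proof (intro conjI allI ballI impI)
  have gf: "g \<odot> f \<in> Hom C a c" using Comp_Hom assms by blast
  then show "g \<odot> f \<in> Arr C" by (simp add: Hom_def)
  fix x h k assume *: "h \<in> Hom C (Cod C (g \<odot> f)) x" "k \<in> Hom C (Cod C (g \<odot> f)) x"
    "h \<odot> (g \<odot> f) = k \<odot> (g \<odot> f)"
  then have **: "h \<in> Hom C c x" "k \<in> Hom C c x" using gf by (auto simp: Hom_def)
  then have "(h \<odot> g) \<odot> f = (k \<odot> g) \<odot> f" using Comp_assoc[OF assms(3,4)] * by metis
  then have "h \<odot> g = k \<odot> g" using epicD[OF assms(1,3)] Comp_Hom[OF assms(4)] ** by blast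
  then show "h = k" using epicD[OF assms(2,4)] ** by blast
qed

lemma monic_cancel:
  assumes "monic C (g \<odot> f)" "f \<in> Hom C a b" "g \<in> Hom C b c"
  shows "monic C f"
  unfolding monic_def
proof (intro conjI allI ballI impI)
  have gf: "g \<odot> f \<in> Hom C a c" using Comp_Hom assms by blast
  show "f \<in> Arr C" using assms(2) by (simp add: Hom_def)
  fix x h k assume *: "h \<in> Hom C x (Dom C f)" "k \<in> Hom C x (Dom C f)" "f \<odot> h = f \<odot> k"
  then have **: "h \<in> Hom C x a" "k \<in> Hom C x a" using assms(2) by (auto simp: Hom_def)
  then have "(g \<odot> f) \<odot> h = (g \<odot> f) \<odot> k" using Comp_assoc[OF _ assms(2,3)] *(3) by metis
  then show "h = k" using monicD[OF assms(1) gf] ** by blast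
qed

text \<open>Cancel \<open>f\<close> in \<open>f \<odot> (g \<odot> f) = f\<close>. With this rule an
  invertibility proof has to compute only one of the two composites.\<close>

lemma monic_right_inverse:
  assumes "monic C f" "f \<in> Hom C a b" "g \<in> Hom C b a" "f \<odot> g = Id C b"
  shows "invertible C f"
proof -
  have "f \<odot> (g \<odot> f) = f \<odot> Id C a"
    using Comp_assoc[OF assms(2,3,2)] assms(2,4) Comp_Id Id_Comp by simp
  then have "g \<odot> f = Id C a"
    using monicD[OF assms(1,2) Comp_Hom[OF assms(2,3)]] Id_Hom Hom_Obj[OF assms(2)] by blast
  then show ?thesis using invertibleI[OF assms(2,3)] assms(4) by simp
qed

lemma invertible_monic: "invertible C f \<Longrightarrow> monic C f"
  by (meson HomI invertible_def monic_left_invertible)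

lemma invertible_comp:
  assumes "invertible C f" "invertible C g" "f \<in> Hom C a b" "g \<in> Hom C b c"
  shows "invertible C (g \<odot> f)"
proof -
  obtain f' where f': "f' \<in> Hom C b a" "f' \<odot> f = Id C a" "f \<odot> f' = Id C b"
    using invertibleE[OF assms(1,3)] .
  obtain g' where g': "g' \<in> Hom C c b" "g' \<odot> g = Id C b" "g \<odot> g' = Id C c"
    using invertibleE[OF assms(2,4)] .
  have "(g \<odot> f) \<odot> (f' \<odot> g') = g \<odot> ((f \<odot> f') \<odot> g')"
    using Comp_assoc[OF Comp_Hom[OF g'(1) f'(1)] assms(3,4)] Comp_assoc[OF g'(1) f'(1) assms(3)] by simp
  also have "\<dots> = Id C c" using f' g' Id_Comp by simp
  finally have "(g \<odot> f) \<odot> (f' \<odot> g') = Id C c" .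
  then show ?thesis
    using monic_right_inverse[OF monic_comp[OF invertible_monic invertible_monic] Comp_Hom Comp_Hom]
      assms f'(1) g'(1) by blast
qed

text \<open>The square determines \<open>f'\<close> as \<open>k \<odot> f\<close> followed by the
  inverse of \<open>h\<close> on the source side.\<close>

lemma invertible_conjugate:
  assumes "invertible C f" "invertible C h" "invertible C k" "f \<in> Hom C a b" "h \<in> Hom C a a'"
    "k \<in> Hom C b b'" "f' \<in> Hom C a' b'" "f' \<odot> h = k \<odot> f"
  shows "invertible C f'"
proof -
  obtain h' where h': "h' \<in> Hom C a' a" "h' \<odot> h = Id C a" "h \<odot> h' = Id C a'"
    using invertibleE[OF assms(2,5)] .
  have "f' = (f' \<odot> h) \<odot> h'" using Comp_assoc[OF h'(1) assms(5,7)] Comp_Id assms(7) h'(3) by simp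
  then have "f' = (k \<odot> f) \<odot> h'" using assms(8) by simp
  moreover have "invertible C h'" by (rule invertibleI[OF h'(1) assms(5) h'(3,2)])
  moreover have "invertible C (k \<odot> f)" using invertible_comp assms by blast
  ultimately show ?thesis using invertible_comp h'(1) Comp_Hom[OF assms(4,6)] by blast
qed

section \<open>Kernels, cokernels and pullbacks\<close>

lemma kernel_monic: assumes "is_kernel C k f" shows "monic C k"
  unfolding monic_def
proof (intro conjI allI ballI impI)
  note kd = is_kernelD[OF assms]
  show "k \<in> Arr C" using kd(2) by (simp add: Hom_def)
  fix x g h assume *: "g \<in> Hom C x (Dom C k)" "h \<in> Hom C x (Dom C k)" "k \<odot> g = k \<odot> h"
  have "zero_arrow C ((f \<odot> k) \<odot> g)" using zero_arrow_pre[OF kd(3) Comp_Hom[OF kd(2,1)] *(1)] .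
  then have "zero_arrow C (f \<odot> (k \<odot> g))" using Comp_assoc[OF *(1) kd(2,1)] by simp
  then have "\<exists>!u. u \<in> Hom C x (Dom C k) \<and> k \<odot> u = k \<odot> g"
    using assms Comp_Hom[OF *(1) kd(2)] unfolding is_kernel_def by blast
  then show "g = h" using * by metis
qed

text \<open>Being a kernel depends only on the subobject, so the property can move between
  representatives of one preradical, and from one kernel to another.\<close>

lemma kernel_equiv:
  assumes "is_kernel C k f" "monic C m" "Cod C m = Dom C f"
    "factors_through C m k" "factors_through C k m"
  shows "is_kernel C m f"
proof -
  note kd = is_kernelD[OF assms(1)]
  have m: "m \<in> Hom C (Dom C m) (Dom C f)" using assms(2,3) by (simp add: monic_def Hom_def)
  obtain u where u: "u \<in> Hom C (Dom C m) (Dom C k)" "k \<odot> u = m" using assms(4) by (auto simp: factors_through_def)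
  obtain v where v: "v \<in> Hom C (Dom C k) (Dom C m)" "m \<odot> v = k" using assms(5) by (auto simp: factors_through_def)
  show ?thesis
  proof (rule is_kernelI[OF kd(1) m _ assms(2)])
    show "zero_arrow C (f \<odot> m)"
      using Comp_assoc[OF u(1) kd(2,1)] zero_arrow_pre[OF kd(3) Comp_Hom[OF kd(2,1)] u(1)] u(2) by simp
    fix x g assume "g \<in> Hom C x (Dom C f)" "zero_arrow C (f \<odot> g)"
    then obtain w where w: "w \<in> Hom C x (Dom C k)" "k \<odot> w = g" using kd(4) by blast
    then have "m \<odot> (v \<odot> w) = g" using Comp_assoc[OF w(1) v(1) m] v(2) by simp
    then show "\<exists>u \<in> Hom C x (Dom C m). m \<odot> u = g" using Comp_Hom[OF w(1) v(1)] by blast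
  qed
qed

text \<open>The arrow \<open>f\<close> kills \<open>m\<close>, hence factors through
  \<open>c\<close>; whatever \<open>c\<close> kills is then killed by \<open>f\<close> and lifts
  through \<open>m\<close>.\<close>

lemma kernel_of_cokernel:
  assumes "is_kernel C m f" "is_cokernel C c m"
  shows "is_kernel C m c"
proof -
  note kd = is_kernelD[OF assms(1)] and cd = is_cokernelD[OF assms(2)]
  have e: "Cod C m = Dom C f" using kd(2) by (simp add: Hom_def)
  note cd = cd[unfolded e]
  obtain f' where f': "f' \<in> Hom C (Cod C c) (Cod C f)" "f' \<odot> c = f" using cd(4)[OF kd(1,3)] by blast
  show ?thesis
  proof (rule is_kernelI[OF cd(2) kd(2) cd(3) kernel_monic[OF assms(1)]])
    fix x g assume g: "g \<in> Hom C x (Dom C f)" "zero_arrow C (c \<odot> g)"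
    have "zero_arrow C (f' \<odot> (c \<odot> g))" using zero_arrow_post[OF g(2) Comp_Hom[OF g(1) cd(2)] f'(1)] .
    then have "zero_arrow C (f \<odot> g)" using Comp_assoc[OF g(1) cd(2) f'(1)] f'(2) by simp
    then show "\<exists>u \<in> Hom C x (Dom C m). m \<odot> u = g" using kd(4) g(1) by blast
  qed
qed

text \<open>This links the two forms of the radical criterion, vanishing of a component of
  \<open>t\<close> and invertibility of the same component of \<open>c\<close>.\<close>

lemma invertible_cokernel_iff:
  assumes "is_cokernel C c f"
  shows "invertible C c \<longleftrightarrow> zero_arrow C f"
proof
  note cd = is_cokernelD[OF assms]
  { assume "invertible C c"
    then show "zero_arrow C f" using monic_reflects_zero[OF invertible_monic] cd by blast
  next
    assume "zero_arrow C f"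
    have o: "Cod C f \<in> Obj C" "Cod C c \<in> Obj C" using Hom_Obj cd(2) by blast+
    \<comment> \<open>When \<open>f\<close> is zero, the identity kills it and so factors through
      \<open>c\<close>. This gives a left inverse of \<open>c\<close>, which is two-sided because
      \<open>c\<close> is epic.\<close>
    have "zero_arrow C (Id C (Cod C f) \<odot> f)" using \<open>zero_arrow C f\<close> Id_Comp[OF cd(1)] by simp
    then obtain u where u: "u \<in> Hom C (Cod C c) (Cod C f)" "u \<odot> c = Id C (Cod C f)"
      using cd(4) Id_Hom[OF o(1)] by blast
    have "(c \<odot> u) \<odot> c = Id C (Cod C c) \<odot> c"
      using Comp_assoc[OF cd(2) u(1) cd(2)] u(2) Comp_Id[OF cd(2)] Id_Comp[OF cd(2)] by simp
    then have "c \<odot> u = Id C (Cod C c)"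
      using epicD[OF cokernel_epic[OF assms] cd(2) Comp_Hom[OF u(1) cd(2)] Id_Hom[OF o(2)]] by blast
    then show "invertible C c" using invertibleI[OF cd(2) u] by simp }
qed

lemma is_pullbackD:
  assumes "is_pullback C f g p q"
  shows "f \<in> Hom C (Dom C f) (Cod C f)" "g \<in> Hom C (Dom C g) (Cod C f)"
    "p \<in> Hom C (Dom C p) (Dom C f)" "q \<in> Hom C (Dom C p) (Dom C g)" "f \<odot> p = g \<odot> q"
    "\<lbrakk>h \<in> Hom C x (Dom C f); k \<in> Hom C x (Dom C g); f \<odot> h = g \<odot> k\<rbrakk> \<Longrightarrow>
       \<exists>!u. u \<in> Hom C x (Dom C p) \<and> p \<odot> u = h \<and> q \<odot> u = k"
proof -
  show "f \<in> Hom C (Dom C f) (Cod C f)" "g \<in> Hom C (Dom C g) (Cod C f)"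
    "p \<in> Hom C (Dom C p) (Dom C f)" "q \<in> Hom C (Dom C p) (Dom C g)" "f \<odot> p = g \<odot> q"
    using assms by (simp_all add: is_pullback_def Hom_def)
qed (use assms in \<open>unfold is_pullback_def, blast\<close>)

text \<open>An arrow \<open>g\<close> is killed by \<open>d \<odot> f\<close> exactly if
  \<open>f \<odot> g\<close> lifts through the kernel \<open>m\<close> of \<open>d\<close>, that is,
  exactly if \<open>g\<close> lifts through the pullback.\<close>

lemma kernel_pullback:
  assumes "is_pullback C f m p q" "is_kernel C m d"
  shows "is_kernel C p (d \<odot> f)"
proof -
  define a b c e where "a = Dom C f" and "b = Dom C m" and "c = Cod C f" and "e = Dom C p"
  note pd = is_pullbackD[OF assms(1), folded a_def b_def c_def e_def]
  note f = pd(1) and m = pd(2) and p = pd(3) and q = pd(4) and eq = pd(5) and univ = pd(6)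
  have mono: "monic C m" using kernel_monic[OF assms(2)] .
  note kd = is_kernelD[OF assms(2)]
  have dm: "Dom C m = b" "Dom C d = c" using m kd(2) by (auto simp: Hom_def)
  note kd = kd[unfolded dm]
  have df: "d \<odot> f \<in> Hom C a (Cod C d)" using Comp_Hom f kd(1) by blast
  show ?thesis
  proof (rule is_kernelI[OF df p])
    have "(d \<odot> f) \<odot> p = (d \<odot> m) \<odot> q" using Comp_assoc[OF p f kd(1)] Comp_assoc[OF q m kd(1)] eq by simp
    then show "zero_arrow C ((d \<odot> f) \<odot> p)" using zero_arrow_pre[OF kd(3) Comp_Hom[OF m kd(1)] q] by simp
    show "monic C p" unfolding monic_def
    proof (intro conjI allI ballI impI)
      show "p \<in> Arr C" using p by (simp add: Hom_def)
      fix x g h assume *: "g \<in> Hom C x (Dom C p)" "h \<in> Hom C x (Dom C p)" "p \<odot> g = p \<odot> h"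
      then have **: "g \<in> Hom C x e" "h \<in> Hom C x e" using p by (auto simp: Hom_def)
      \<comment> \<open>The pullback square turns equality after \<open>p\<close> into equality
        after \<open>m \<odot> q\<close>; cancelling \<open>m\<close> gives equality after
        \<open>q\<close>, and the uniqueness part of the pullback finishes.\<close>
      have fg: "f \<odot> (p \<odot> g) = m \<odot> (q \<odot> g)" if "g \<in> Hom C x e" for g
        using Comp_assoc[OF that p f] Comp_assoc[OF that q m] eq by simp
      have "m \<odot> (q \<odot> g) = m \<odot> (q \<odot> h)" using fg ** *(3) by metis
      then have "q \<odot> g = q \<odot> h" using monicD[OF mono m] Comp_Hom[OF _ q] ** by blast
      then show "g = h" using univ[OF Comp_Hom[OF **(1) p] Comp_Hom[OF **(1) q] fg[OF **(1)]] ** *(3) by metis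
    qed
    fix x g assume g: "g \<in> Hom C x a" "zero_arrow C ((d \<odot> f) \<odot> g)"
    then have "zero_arrow C (d \<odot> (f \<odot> g))" using Comp_assoc[OF g(1) f kd(1)] by simp
    then obtain w where "w \<in> Hom C x b" "m \<odot> w = f \<odot> g" using kd(4) Comp_Hom[OF g(1) f] by blast
    then show "\<exists>u \<in> Hom C x e. p \<odot> u = g" using univ[OF g(1)] by metis
  qed
qed

text \<open>If \<open>m\<close> is zero, commutativity \<open>f \<odot> h = m \<odot> l\<close> just
  says that \<open>f\<close> kills \<open>h\<close>. As \<open>m\<close> is also monic, the other
  leg \<open>l\<close> is forced to be zero.\<close>

lemma pullback_zero_monic:
  assumes "is_kernel C k f" "monic C m" "zero_arrow C m" "Cod C m = Cod C f"
  shows "\<exists>q. is_pullback C f m k q"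
proof -
  note kd = is_kernelD[OF assms(1)]
  have m: "m \<in> Hom C (Dom C m) (Cod C f)" using assms(2,4) by (simp add: monic_def Hom_def)
  obtain z where "zero_object C z" using assms(3) by (auto simp: zero_arrow_def)
  then obtain q where q: "q \<in> Hom C (Dom C k) (Dom C m)" "zero_arrow C q"
    using ex_zero_arrow Hom_Obj[OF kd(2)] Hom_Obj[OF m] by metis
  have "is_pullback C f m k q" unfolding is_pullback_def
  proof (intro conjI allI ballI impI)
    show "f \<odot> k = m \<odot> q"
      using zero_arrow_unique[OF kd(3) zero_arrow_post[OF q(2,1) m] Comp_Hom[OF kd(2,1)] Comp_Hom[OF q(1) m]] .
    fix x h l assume *: "h \<in> Hom C x (Dom C f)" "l \<in> Hom C x (Dom C m)" "f \<odot> h = m \<odot> l"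
    have "zero_arrow C (f \<odot> h)" using zero_arrow_pre[OF assms(3) m *(2)] *(3) by simp
    then obtain u where u: "u \<in> Hom C x (Dom C k)" "k \<odot> u = h" using kd(4) *(1) by blast
    have "zero_arrow C l" using monic_reflects_zero[OF assms(2) m *(2)] zero_arrow_pre[OF assms(3) m *(2)] by simp
    then have "q \<odot> u = l" using zero_arrow_unique[OF zero_arrow_pre[OF q(2,1) u(1)] _ Comp_Hom[OF u(1) q(1)] *(2)] by simp
    moreover have "v = u" if "v \<in> Hom C x (Dom C k)" "k \<odot> v = h" for v
      using monicD[OF kernel_monic[OF assms(1)] kd(2) that(1) u(1)] that(2) u(2) by simp
    ultimately show "\<exists>!u. u \<in> Hom C x (Dom C k) \<and> k \<odot> u = h \<and> q \<odot> u = l" using u by blast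
  qed (use kd m q assms(4) in \<open>auto simp: Hom_def\<close>)
  then show ?thesis by blast
qed

end

text \<open>The place where arrows are subtracted: equality of \<open>f\<close> and \<open>g\<close>
  is tested on their difference. The work lies in matching zero arrows, defined through zero
  objects, with the neutral elements of the hom groups.\<close>

lemma (in abelian_category) monic_if_reflects_zero:
  assumes t: "t \<in> Hom C a b"
    and refl: "\<And>x h. \<lbrakk>h \<in> Hom C x a; zero_arrow C (t \<odot> h)\<rbrakk> \<Longrightarrow> zero_arrow C h"
  shows "monic C t"
  unfolding monic_def
proof (intro conjI allI ballI impI)
  show "t \<in> Arr C" using t by (simp add: Hom_def)
  obtain add where pre: "preadditive C add" using additive by blast
  obtain z where z: "zero_object C z" using ex_zero_object by blast
  have grp: "\<exists>e. comm_group \<lparr>carrier = Hom C x y, mult = add, one = e\<rparr>" if "x \<in> Obj C" "y \<in> Obj C" for x y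
    using pre that by (auto simp: preadditive_def)
  \<comment> \<open>Write \<open>f = q \<odot> p\<close> through a zero object. Arrows out of a zero
    object are unique, so \<open>add q q = q\<close>; hence \<open>add f f = f\<close>, and
    cancellation makes \<open>f\<close> neutral.\<close>
  have zero_one: "f = e" if zf: "zero_arrow C f" "f \<in> Hom C x y" and
      "comm_group \<lparr>carrier = Hom C x y, mult = add, one = e\<rparr>" for f x y e
  proof -
    interpret G: comm_group "\<lparr>carrier = Hom C x y, mult = add, one = e\<rparr>" by fact
    obtain w p q where w: "zero_object C w" "p \<in> Hom C x w" "q \<in> Hom C w y" "f = q \<odot> p"
      using zf HomD unfolding zero_arrow_def by metis
    obtain e' where "comm_group \<lparr>carrier = Hom C w y, mult = add, one = e'\<rparr>"
      using grp Hom_Obj[OF w(3)] by blast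
    then interpret H: comm_group "\<lparr>carrier = Hom C w y, mult = add, one = e'\<rparr>" .
    have "add q q = q" using zero_objectD(4)[OF w(1) Hom_Obj(2)[OF w(3)]] H.m_closed[of q q] w(3) by simp
    moreover have "add q q \<odot> p = add (q \<odot> p) (q \<odot> p)" using pre w(2,3) unfolding preadditive_def by blast
    ultimately have "add f f = f" using w(4) by simp
    then show "f = e" using G.l_cancel_one[of f f] zf(2) by simp
  qed
  fix x f g assume *: "f \<in> Hom C x (Dom C t)" "g \<in> Hom C x (Dom C t)" "t \<odot> f = t \<odot> g"
  then have f: "f \<in> Hom C x a" and g: "g \<in> Hom C x a" using t by (auto simp: Hom_def)
  obtain e e' where "comm_group \<lparr>carrier = Hom C x a, mult = add, one = e\<rparr>"
    and "comm_group \<lparr>carrier = Hom C x b, mult = add, one = e'\<rparr>"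
    using grp Hom_Obj[OF f] Hom_Obj[OF t] by blast
  then interpret G: comm_group "\<lparr>carrier = Hom C x a, mult = add, one = e\<rparr>"
    + H: comm_group "\<lparr>carrier = Hom C x b, mult = add, one = e'\<rparr>" .
  \<comment> \<open>\<open>h\<close> is the difference of \<open>f\<close> and \<open>g\<close>,
    arranged so that \<open>add h g = f\<close>.\<close>
  obtain g' where g': "g' \<in> Hom C x a" "add g' g = e" using G.l_inv_ex[of g] g by auto
  define h where "h = add f g'"
  have h: "h \<in> Hom C x a" using G.m_closed[of f g'] f g' by (simp add: h_def)
  have hg: "add h g = f" using G.m_assoc[of f g' g] G.r_one[of f] f g g' by (simp add: h_def)
  have th: "t \<odot> h \<in> Hom C x b" "t \<odot> g \<in> Hom C x b" using Comp_Hom[OF _ t] h g by blast+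
  have "t \<odot> add h g = add (t \<odot> h) (t \<odot> g)" using pre t h g unfolding preadditive_def by blast
  then have "add (t \<odot> h) (t \<odot> g) = t \<odot> g" using hg *(3) by simp
  then have "t \<odot> h = e'" using H.r_cancel_one[of "t \<odot> g" "t \<odot> h"] th by simp
  \<comment> \<open>\<open>zero_one\<close> goes from zero arrows to neutral elements. Applied to a
    zero arrow \<open>o'\<close>, it shows that the neutral element \<open>e'\<close> is itself a
    zero arrow.\<close>
  moreover obtain o' where "o' \<in> Hom C x b" "zero_arrow C o'"
    using ex_zero_arrow[OF z] Hom_Obj[OF f] Hom_Obj[OF t] by blast
  ultimately have "zero_arrow C (t \<odot> h)" using zero_one H.comm_group_axioms by blast
  then have "h = e" using zero_one[OF refl h G.comm_group_axioms] h by blast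
  then show "f = g" using hg G.l_one[of g] g by simp
qed


section \<open>Opposite categories\<close>

lemma zero_object_op: "zero_object (op_cat C) z \<longleftrightarrow> zero_object C z"
  unfolding zero_object_def op_sel by blast

lemma zero_arrow_op: "zero_arrow (op_cat C) f \<longleftrightarrow> zero_arrow C f"
  unfolding zero_arrow_def op_sel zero_object_op by blast

lemma is_kernel_op: "is_kernel (op_cat C) k f \<longleftrightarrow> is_cokernel C k f"
  unfolding is_kernel_def is_cokernel_def op_sel zero_arrow_op ..

lemma is_cokernel_op: "is_cokernel (op_cat C) k f \<longleftrightarrow> is_kernel C k f"
  unfolding is_kernel_def is_cokernel_def op_sel zero_arrow_op ..

lemma monic_op_cat: "monic (op_cat C) f \<longleftrightarrow> epic C f"
  unfolding monic_def epic_def op_sel ..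

lemma epic_op_cat: "epic (op_cat C) f \<longleftrightarrow> monic C f"
  unfolding monic_def epic_def op_sel ..

lemma invertible_op: "invertible (op_cat C) f \<longleftrightarrow> invertible C f"
  unfolding invertible_def op_sel by blast

lemma preadditive_op: "preadditive C add \<Longrightarrow> preadditive (op_cat C) add"
  unfolding preadditive_def op_sel by blast

lemma has_biproduct_op: "has_biproduct C add a b \<Longrightarrow> has_biproduct (op_cat C) add a b"
  unfolding has_biproduct_def op_sel by blast

text \<open>The axioms come in dual pairs, and a biproduct stays one when injections and projections
  trade places. Every result on kernels can thus be reread as one on cokernels.\<close>

lemma abelian_category_op:
  assumes "abelian_category C"
  shows "abelian_category (op_cat C)"
proof -
  interpret C: abelian_category C by fact
  interpret op: category "op_cat C" using category_op C.category_axioms .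
  show ?thesis
  proof
    show "\<exists>z. zero_object (op_cat C) z" unfolding zero_object_op by (rule C.ex_zero_object)
    obtain add where "preadditive C add" "\<forall>a\<in>Obj C. \<forall>b\<in>Obj C. has_biproduct C add a b"
      using C.additive by blast
    then have "preadditive (op_cat C) add"
      "\<forall>a\<in>Obj (op_cat C). \<forall>b\<in>Obj (op_cat C). has_biproduct (op_cat C) add a b"
      by (simp_all add: preadditive_op has_biproduct_op op_sel)
    then show "\<exists>add. preadditive (op_cat C) add \<and>
        (\<forall>a\<in>Obj (op_cat C). \<forall>b\<in>Obj (op_cat C). has_biproduct (op_cat C) add a b)"
      by blast
  qed (simp_all add: is_kernel_op is_cokernel_op monic_op_cat epic_op_cat op_sel C.ex_kernel
      C.ex_cokernel C.monic_normal C.epic_normal)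
qed

text \<open>A transformation records its source and target, so
  \<open>functor_category (op_cat C) (op_cat D)\<close> is only isomorphic to
  \<open>op_cat (functor_category C D)\<close>. Quantifiers over arrows have to be moved along the
  involution \<open>op_nat_trans\<close>.\<close>

lemma op_nat_trans_ex1: "(\<exists>!g. P g) \<longleftrightarrow> (\<exists>!g. P (op_nat_trans g))"
  by (metis op_nt_sel(4))

lemma op_nat_trans_inject: "op_nat_trans s = op_nat_trans t \<longleftrightarrow> s = t"
  by (metis op_nt_sel(4))

lemma zero_object_fc_op:
  "zero_object (functor_category (op_cat C) (op_cat D)) Z \<longleftrightarrow> zero_object (functor_category C D) Z"
  unfolding zero_object_def fc_sel(1) is_functor_op
  by (subst (1 2) op_nat_trans_ex1) (auto simp: Hom_op)

lemma zero_arrow_fc_op: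
  "zero_arrow (functor_category (op_cat C) (op_cat D)) (op_nat_trans t)
     \<longleftrightarrow> zero_arrow (functor_category C D) t" (is "zero_arrow ?G _ \<longleftrightarrow> zero_arrow ?F _")
proof -
  have *: "(\<exists>g\<in>Hom ?G a b. P g) \<longleftrightarrow> (\<exists>g\<in>Hom ?F b a. P (op_nat_trans g))" for a b P
    unfolding Bex_def by (metis Hom_op op_nt_sel(4))
  show ?thesis unfolding zero_arrow_def zero_object_fc_op * comp_op op_nat_trans_inject
    by (auto simp: fc_sel is_nat_trans_op op_nt_sel)
qed

lemma is_cokernel_fc_op:
  "is_cokernel (functor_category (op_cat C) (op_cat D)) (op_nat_trans k) (op_nat_trans t)
     \<longleftrightarrow> is_kernel (functor_category C D) k t" (is "is_cokernel ?G _ _ \<longleftrightarrow> is_kernel ?F _ _")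
proof -
  have *: "(\<forall>g\<in>Hom ?G a b. P g) \<longleftrightarrow> (\<forall>g\<in>Hom ?F b a. P (op_nat_trans g))" for a b P
    unfolding Ball_def by (metis Hom_op op_nt_sel(4))
  have **: "(\<exists>!g. g \<in> Hom ?G a b \<and> P g) \<longleftrightarrow> (\<exists>!g. g \<in> Hom ?F b a \<and> P (op_nat_trans g))" for a b P
    by (subst op_nat_trans_ex1) (simp add: Hom_op)
  show ?thesis unfolding is_cokernel_def is_kernel_def * ** comp_op op_nat_trans_inject zero_arrow_fc_op
    by (simp add: fc_sel is_nat_trans_op op_nt_sel)
qed

lemma is_kernel_fc_op:
  "is_kernel (functor_category (op_cat C) (op_cat D)) (op_nat_trans c) (op_nat_trans t)
     \<longleftrightarrow> is_cokernel (functor_category C D) c t"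
  using is_cokernel_fc_op[of "op_cat C" "op_cat D" "op_nat_trans c" "op_nat_trans t"]
  by (simp add: op_sel op_nt_sel)


section \<open>Kernels and monics in functor categories are componentwise\<close>

lemma is_functorD:
  assumes "is_functor C D F"
  shows "a \<in> Obj C \<Longrightarrow> FObj F a \<in> Obj D" "f \<in> Hom C a b \<Longrightarrow> FArr F f \<in> Hom D (FObj F a) (FObj F b)"
    "a \<in> Obj C \<Longrightarrow> FArr F (Id C a) = Id D (FObj F a)"
    "\<lbrakk>f \<in> Hom C a b; g \<in> Hom C b c\<rbrakk> \<Longrightarrow> FArr F (g \<odot>\<^bsub>C\<^esub> f) = FArr F g \<odot>\<^bsub>D\<^esub> FArr F f"
  using assms unfolding is_functor_def Hom_def by auto

lemma is_nat_transD:
  assumes "is_nat_trans C D t"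
  shows "is_functor C D (Src t)" "is_functor C D (Tgt t)"
    "a \<in> Obj C \<Longrightarrow> Cpt t a \<in> Hom D (FObj (Src t) a) (FObj (Tgt t) a)"
    "f \<in> Hom C a b \<Longrightarrow> FArr (Tgt t) f \<odot>\<^bsub>D\<^esub> Cpt t a = Cpt t b \<odot>\<^bsub>D\<^esub> FArr (Src t) f"
  using assms unfolding is_nat_trans_def Hom_def by auto

lemma Hom_fc: "t \<in> Hom (functor_category C D) F G \<longleftrightarrow> is_nat_trans C D t \<and> Src t = F \<and> Tgt t = G"
  by (simp add: Hom_def fc_sel)

lemma Cpt_comp: "a \<in> Obj C \<Longrightarrow> Cpt (t \<odot>\<^bsub>functor_category C D\<^esub> s) a = Cpt t a \<odot>\<^bsub>D\<^esub> Cpt s a"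
  by (simp add: fc_sel)

text \<open>Monicity makes the restricted action on arrows unique, and both functor laws follow by
  cancelling. The prescribed monics are kept as the components, so that a family of chosen kernels
  becomes a kernel transformation.\<close>

lemma ex_subfunctor:
  assumes "category C" "category D" "is_functor C D F"
    and mono: "\<And>a. a \<in> Obj C \<Longrightarrow> monic D (m a) \<and> Cod D (m a) = FObj F a"
    and stable: "\<And>a b f. f \<in> Hom C a b \<Longrightarrow>
      \<exists>u \<in> Hom D (Dom D (m a)) (Dom D (m b)). m b \<odot>\<^bsub>D\<^esub> u = FArr F f \<odot>\<^bsub>D\<^esub> m a"
  shows "\<exists>k. is_nat_trans C D k \<and> Tgt k = F \<and> (\<forall>a \<in> Obj C. Cpt k a = m a)"
proof -
  interpret C: category C by fact
  interpret D: category D by fact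
  note F = is_functorD[OF assms(3)]
  define K where "K = (\<lambda>a. Dom D (m a))"
  have m: "m a \<in> Hom D (K a) (FObj F a)" and mm: "monic D (m a)" if "a \<in> Obj C" for a
    using mono[OF that] by (auto simp: monic_def Hom_def K_def)
  have KO: "K a \<in> Obj D" if "a \<in> Obj C" for a using D.Hom_Obj m that by blast
  \<comment> \<open>The choice is harmless: \<open>m (Cod C f)\<close> is monic, so at most one such
    \<open>u\<close> exists.\<close>
  define KA where "KA = (\<lambda>f. SOME u. u \<in> Hom D (K (Dom C f)) (K (Cod C f)) \<and>
      m (Cod C f) \<odot>\<^bsub>D\<^esub> u = FArr F f \<odot>\<^bsub>D\<^esub> m (Dom C f))"
  have KA: "KA f \<in> Hom D (K a) (K b) \<and> m b \<odot>\<^bsub>D\<^esub> KA f = FArr F f \<odot>\<^bsub>D\<^esub> m a" if f: "f \<in> Hom C a b" for f a b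
  proof -
    have "\<exists>u. u \<in> Hom D (K a) (K b) \<and> m b \<odot>\<^bsub>D\<^esub> u = FArr F f \<odot>\<^bsub>D\<^esub> m a"
      using stable[OF f] unfolding K_def by blast
    from someI_ex[OF this] show ?thesis using f by (simp add: KA_def Hom_def)
  qed
  have KA_Id: "KA (Id C a) = Id D (K a)" if a: "a \<in> Obj C" for a
  proof (rule monicD[OF mm[OF a] m[OF a]])
    show "KA (Id C a) \<in> Hom D (K a) (K a)" "Id D (K a) \<in> Hom D (K a) (K a)"
      using KA C.Id_Hom[OF a] D.Id_Hom[OF KO[OF a]] by blast+
    show "m a \<odot>\<^bsub>D\<^esub> KA (Id C a) = m a \<odot>\<^bsub>D\<^esub> Id D (K a)"
      using KA[OF C.Id_Hom[OF a]] F(3)[OF a] D.Id_Comp[OF m[OF a]] D.Comp_Id[OF m[OF a]] by simp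
  qed
  have KA_comp: "KA (g \<odot>\<^bsub>C\<^esub> f) = KA g \<odot>\<^bsub>D\<^esub> KA f" if f: "f \<in> Hom C a b" and g: "g \<in> Hom C b c" for a b c f g
  proof -
    have o: "a \<in> Obj C" "b \<in> Obj C" "c \<in> Obj C" using C.Hom_Obj f g by blast+
    note gf = C.Comp_Hom[OF f g]
    note k = conjunct1[OF KA[OF f]] conjunct1[OF KA[OF g]]
    note e = conjunct2[OF KA[OF f]] conjunct2[OF KA[OF g]]
    have "m c \<odot>\<^bsub>D\<^esub> (KA g \<odot>\<^bsub>D\<^esub> KA f) = FArr F g \<odot>\<^bsub>D\<^esub> (m b \<odot>\<^bsub>D\<^esub> KA f)"
      using D.Comp_assoc[OF k m[OF o(3)]] D.Comp_assoc[OF k(1) m[OF o(2)] F(2)[OF g]] e(2) by simp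
    also have "\<dots> = m c \<odot>\<^bsub>D\<^esub> KA (g \<odot>\<^bsub>C\<^esub> f)"
      using D.Comp_assoc[OF m[OF o(1)] F(2)[OF f] F(2)[OF g]] e(1) F(4)[OF f g] KA[OF gf] by simp
    finally show ?thesis using monicD[OF mm[OF o(3)] m[OF o(3)] _ D.Comp_Hom[OF k]] KA[OF gf] by metis
  qed
  let ?K = "\<lparr>FObj = \<lambda>a\<in>Obj C. K a, FArr = \<lambda>f\<in>Arr C. KA f\<rparr>"
  let ?k = "\<lparr>Src = ?K, Tgt = F, Cpt = \<lambda>a\<in>Obj C. m a\<rparr>"
  note A = HomI[of _ C] and O = C.Dom_Obj C.Cod_Obj
  have "is_functor C D ?K" unfolding is_functor_def
  proof (intro conjI ballI impI)
    show "FArr ?K \<in> Arr C \<rightarrow>\<^sub>E Arr D" using KA[OF A] by (auto simp: Hom_def)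
    show "FArr ?K f \<in> Hom D (FObj ?K (Dom C f)) (FObj ?K (Cod C f))" if "f \<in> Arr C" for f
      using KA[OF A] O that by simp
    show "FArr ?K (Id C a) = Id D (FObj ?K a)" if "a \<in> Obj C" for a
      using KA_Id[OF that] that HomD[OF C.Id_Hom[OF that]] by simp
    show "FArr ?K (g \<odot>\<^bsub>C\<^esub> f) = FArr ?K g \<odot>\<^bsub>D\<^esub> FArr ?K f"
      if "f \<in> Arr C" "g \<in> Arr C" "Dom C g = Cod C f" for f g
      using KA_comp[OF A A[of g, unfolded that(3)]] HomD[OF C.Comp_Hom'[OF that]] that by simp
  qed (use KO in simp)
  then have "is_nat_trans C D ?k" unfolding is_nat_trans_def using assms(3) m O KA[OF A] by simp
  then show ?thesis by (intro exI[of _ ?k]) simp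
qed

lemma monic_fcI:
  assumes "is_nat_trans C D t" "\<And>a. a \<in> Obj C \<Longrightarrow> monic D (Cpt t a)"
  shows "monic (functor_category C D) t"
  unfolding monic_def
proof (intro conjI allI ballI impI)
  let ?F = "functor_category C D"
  show "t \<in> Arr ?F" using assms(1) by (simp add: fc_sel)
  fix X f g assume *: "f \<in> Hom ?F X (Dom ?F t)" "g \<in> Hom ?F X (Dom ?F t)" "t \<odot>\<^bsub>?F\<^esub> f = t \<odot>\<^bsub>?F\<^esub> g"
  then have fg: "is_nat_trans C D f" "is_nat_trans C D g" "Src f = X" "Src g = X" "Tgt f = Src t" "Tgt g = Src t"
    by (auto simp: Hom_fc fc_sel(3))
  show "f = g"
  proof (rule nt_eqI[OF fg(1,2)])
    fix a assume a: "a \<in> Obj C"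
    have "Cpt t a \<odot>\<^bsub>D\<^esub> Cpt f a = Cpt t a \<odot>\<^bsub>D\<^esub> Cpt g a" using *(3) Cpt_comp[OF a] by metis
    then show "Cpt f a = Cpt g a"
      using monicD[OF assms(2)[OF a] is_nat_transD(3)[OF assms(1) a]]
        is_nat_transD(3)[OF fg(1) a] is_nat_transD(3)[OF fg(2) a] fg by metis
  qed (use fg in simp_all)
qed

text \<open>Pointwise factorisations are natural without further assumption: the two sides of a
  naturality square agree after the monic component of \<open>k\<close>.\<close>

lemma factors_through_fcI:
  assumes "category C" "category D" "is_nat_trans C D k" "is_nat_trans C D g" "Tgt g = Tgt k"
    and mono: "\<And>a. a \<in> Obj C \<Longrightarrow> monic D (Cpt k a)"
    and fact: "\<And>a. a \<in> Obj C \<Longrightarrow> factors_through D (Cpt g a) (Cpt k a)"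
  shows "factors_through (functor_category C D) g k"
proof -
  interpret C: category C by fact
  interpret D: category D by fact
  let ?F = "functor_category C D"
  interpret F: category ?F using category_fc assms(1,2) .
  note k = is_nat_transD[OF assms(3)] and g = is_nat_transD[OF assms(4)]
  have "\<exists>u. u \<in> Hom D (FObj (Src g) a) (FObj (Src k) a) \<and> Cpt k a \<odot>\<^bsub>D\<^esub> u = Cpt g a" if "a \<in> Obj C" for a
    using fact[OF that] k(3)[OF that] g(3)[OF that] unfolding factors_through_def Hom_def by auto
  then obtain u where u: "\<And>a. a \<in> Obj C \<Longrightarrow> u a \<in> Hom D (FObj (Src g) a) (FObj (Src k) a)"
    and ku: "\<And>a. a \<in> Obj C \<Longrightarrow> Cpt k a \<odot>\<^bsub>D\<^esub> u a = Cpt g a"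
    by metis
  let ?u = "\<lparr>Src = Src g, Tgt = Src k, Cpt = \<lambda>a\<in>Obj C. u a\<rparr>"
  have nat: "FArr (Src k) f \<odot>\<^bsub>D\<^esub> u a = u b \<odot>\<^bsub>D\<^esub> FArr (Src g) f" if f: "f \<in> Hom C a b" for a b f
  proof -
    have o: "a \<in> Obj C" "b \<in> Obj C" using C.Hom_Obj f by blast+
    note kf = is_functorD(2)[OF k(1) f] and gf = is_functorD(2)[OF g(1) f]
      and tf = is_functorD(2)[OF k(2) f]
    have "Cpt k b \<odot>\<^bsub>D\<^esub> (FArr (Src k) f \<odot>\<^bsub>D\<^esub> u a) = FArr (Tgt k) f \<odot>\<^bsub>D\<^esub> Cpt g a"
      using D.Comp_assoc[OF u[OF o(1)] kf k(3)[OF o(2)]] D.Comp_assoc[OF u[OF o(1)] k(3)[OF o(1)] tf]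
        k(4)[OF f] ku[OF o(1)] by simp
    also have "\<dots> = Cpt k b \<odot>\<^bsub>D\<^esub> (u b \<odot>\<^bsub>D\<^esub> FArr (Src g) f)"
      using D.Comp_assoc[OF gf u[OF o(2)] k(3)[OF o(2)]] g(4)[OF f] ku[OF o(2)] assms(5) by simp
    finally show ?thesis
      using monicD[OF mono[OF o(2)] k(3)[OF o(2)] D.Comp_Hom[OF u[OF o(1)] kf] D.Comp_Hom[OF gf u[OF o(2)]]]
      by simp
  qed
  have nu: "is_nat_trans C D ?u" unfolding is_nat_trans_def
    using k(1) g(1) u nat[OF HomI] C.Dom_Obj C.Cod_Obj by simp
  have "is_nat_trans C D (k \<odot>\<^bsub>?F\<^esub> ?u)" using Comp_nt[OF assms(1,2) nu assms(3)] by (simp add: fc_sel)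
  then have "k \<odot>\<^bsub>?F\<^esub> ?u = g"
    by (rule nt_eqI[OF _ assms(4)]) (use ku assms(5) in \<open>simp_all add: fc_sel\<close>)
  then show ?thesis using nu unfolding factors_through_def
    by (intro bexI[of _ ?u]) (simp_all add: Hom_fc fc_sel(3))
qed

lemma is_kernel_fcI:
  assumes "category C" "abelian_category D" "is_nat_trans C D k" "is_nat_trans C D t" "Tgt k = Src t"
    and ker: "\<And>a. a \<in> Obj C \<Longrightarrow> is_kernel D (Cpt k a) (Cpt t a)"
  shows "is_kernel (functor_category C D) k t"
proof -
  interpret D: abelian_category D by fact
  let ?F = "functor_category C D"
  note cat = assms(1) D.category_axioms
  interpret F: category ?F using category_fc cat .
  obtain z where z: "zero_object D z" using D.ex_zero_object by blast
  have mono: "monic D (Cpt k a)" if "a \<in> Obj C" for a using D.kernel_monic[OF ker[OF that]] .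
  have t: "t \<in> Hom ?F (Src t) (Tgt t)" and k: "k \<in> Hom ?F (Src k) (Src t)" using assms by (simp_all add: Hom_fc)
  show ?thesis
  proof (rule is_kernelI[OF t k])
    show "zero_arrow ?F (t \<odot>\<^bsub>?F\<^esub> k)"
      using zero_arrow_fc[OF cat z, of "t \<odot>\<^bsub>?F\<^esub> k"] F.Comp_Hom[OF k t] is_kernelD(3)[OF ker]
      by (simp add: Hom_fc Cpt_comp)
    show "monic ?F k" using monic_fcI[OF assms(3) mono] .
    fix X g assume g: "g \<in> Hom ?F X (Src t)" "zero_arrow ?F (t \<odot>\<^bsub>?F\<^esub> g)"
    then have gn: "is_nat_trans C D g" "Src g = X" "Tgt g = Src t" by (simp_all add: Hom_fc)
    have "factors_through D (Cpt g a) (Cpt k a)" if a: "a \<in> Obj C" for a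
    proof -
      have "zero_arrow D (Cpt t a \<odot>\<^bsub>D\<^esub> Cpt g a)"
        using zero_arrow_fc[OF cat z, of "t \<odot>\<^bsub>?F\<^esub> g"] F.Comp_Hom[OF g(1) t] g(2) a
        by (simp add: Hom_fc Cpt_comp)
      moreover have "Cpt g a \<in> Hom D (Dom D (Cpt g a)) (Dom D (Cpt t a))"
        using is_nat_transD(3)[OF gn(1) a] is_nat_transD(3)[OF assms(4) a] gn(3) by (simp add: Hom_def)
      ultimately show ?thesis using is_kernelD(4)[OF ker[OF a]] unfolding factors_through_def by blast
    qed
    then have "factors_through ?F g k" using factors_through_fcI[OF cat assms(3) gn(1) _ mono] gn(3) assms(5) by simp
    then show "\<exists>u\<in>Hom ?F X (Src k). k \<odot>\<^bsub>?F\<^esub> u = g" using gn(2) by (simp add: factors_through_def fc_sel(3))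
  qed
qed

text \<open>The kernel is assembled from chosen kernels in \<open>D\<close>. Its description on
  components is part of the conclusion, since it is later transported to arbitrary kernels.\<close>

lemma ex_kernel_fc:
  assumes "category C" "abelian_category D" "is_nat_trans C D t"
  shows "\<exists>k. is_kernel (functor_category C D) k t \<and> (\<forall>a \<in> Obj C. is_kernel D (Cpt k a) (Cpt t a))"
proof -
  interpret C: category C by fact
  interpret D: abelian_category D by fact
  note t = is_nat_transD[OF assms(3)]
  have "\<exists>k. is_kernel D k (Cpt t a)" if "a \<in> Obj C" for a
    using D.ex_kernel t(3)[OF that] HomD by metis
  then obtain m where m: "\<And>a. a \<in> Obj C \<Longrightarrow> is_kernel D (m a) (Cpt t a)" by metis
  have dt: "Dom D (Cpt t a) = FObj (Src t) a" if "a \<in> Obj C" for a using t(3)[OF that] by (simp add: Hom_def)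
  have kd: "m a \<in> Hom D (Dom D (m a)) (FObj (Src t) a)" "zero_arrow D (Cpt t a \<odot>\<^bsub>D\<^esub> m a)"
    "\<And>x g. \<lbrakk>g \<in> Hom D x (FObj (Src t) a); zero_arrow D (Cpt t a \<odot>\<^bsub>D\<^esub> g)\<rbrakk> \<Longrightarrow>
      \<exists>u \<in> Hom D x (Dom D (m a)). m a \<odot>\<^bsub>D\<^esub> u = g" if "a \<in> Obj C" for a
    using is_kernelD(2-4)[OF m[OF that]] dt[OF that] by simp_all
  have "\<exists>k. is_nat_trans C D k \<and> Tgt k = Src t \<and> (\<forall>a \<in> Obj C. Cpt k a = m a)"
  proof (rule ex_subfunctor[OF assms(1) D.category_axioms t(1)])
    show "monic D (m a) \<and> Cod D (m a) = FObj (Src t) a" if "a \<in> Obj C" for a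
      using D.kernel_monic[OF m[OF that]] kd(1)[OF that] by (simp add: Hom_def)
    fix a b f assume f: "f \<in> Hom C a b"
    then have o: "a \<in> Obj C" "b \<in> Obj C" using C.Hom_Obj by blast+
    note sf = is_functorD(2)[OF t(1) f] and tf = is_functorD(2)[OF t(2) f]
    have k: "m a \<in> Hom D (Dom D (m a)) (FObj (Src t) a)" using kd(1)[OF o(1)] .
    \<comment> \<open>Stability of the family: by naturality \<open>Cpt t b\<close> kills the
      restriction of \<open>FArr (Src t) f\<close> to \<open>m a\<close>, which therefore lifts
      through \<open>m b\<close>.\<close>
    have "zero_arrow D (FArr (Tgt t) f \<odot>\<^bsub>D\<^esub> (Cpt t a \<odot>\<^bsub>D\<^esub> m a))"
      using D.zero_arrow_post[OF kd(2)[OF o(1)] D.Comp_Hom[OF k t(3)[OF o(1)]] tf] .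
    then have "zero_arrow D (Cpt t b \<odot>\<^bsub>D\<^esub> (FArr (Src t) f \<odot>\<^bsub>D\<^esub> m a))"
      using D.Comp_assoc[OF k t(3)[OF o(1)] tf] D.Comp_assoc[OF k sf t(3)[OF o(2)]] t(4)[OF f] by simp
    then show "\<exists>u\<in>Hom D (Dom D (m a)) (Dom D (m b)). m b \<odot>\<^bsub>D\<^esub> u = FArr (Src t) f \<odot>\<^bsub>D\<^esub> m a"
      using kd(3)[OF o(2) D.Comp_Hom[OF k sf]] by simp
  qed
  then obtain k where k: "is_nat_trans C D k" "Tgt k = Src t" "\<forall>a \<in> Obj C. Cpt k a = m a" by blast
  then have "is_kernel (functor_category C D) k t" using is_kernel_fcI[OF assms(1,2) k(1) assms(3) k(2)] m by simp
  then show ?thesis using k(3) m by auto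
qed

text \<open>A monic \<open>t\<close> has a zero kernel. That kernel is computed on components, so
  each component of \<open>t\<close> has zero kernel, which in an abelian category makes it
  monic.\<close>

lemma monic_fcD:
  assumes "category C" "abelian_category D" "monic (functor_category C D) t" "a \<in> Obj C"
  shows "monic D (Cpt t a)"
proof -
  interpret D: abelian_category D by fact
  let ?F = "functor_category C D"
  note cat = assms(1) D.category_axioms
  interpret F: category ?F using category_fc cat .
  obtain z where z: "zero_object D z" using D.ex_zero_object by blast
  have nt: "is_nat_trans C D t" using assms(3) by (simp add: monic_def fc_sel)
  obtain k where k: "is_kernel ?F k t" "is_kernel D (Cpt k a) (Cpt t a)"
    using ex_kernel_fc[OF assms(1,2) nt] assms(4) by blast
  have "zero_arrow ?F k" using F.monic_reflects_zero[OF assms(3)] is_kernelD[OF k(1)] by blast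
  then have z: "zero_arrow D (Cpt k a)"
    using zero_arrow_fc[OF cat z, of k] assms(4) k(1) by (simp add: is_kernel_def fc_sel)
  show ?thesis
  proof (rule D.monic_if_reflects_zero)
    note kd = is_kernelD[OF k(2)]
    show "Cpt t a \<in> Hom D (Dom D (Cpt t a)) (Cod D (Cpt t a))" by (rule kd(1))
    fix x h assume "h \<in> Hom D x (Dom D (Cpt t a))" "zero_arrow D (Cpt t a \<odot>\<^bsub>D\<^esub> h)"
    then obtain u where "u \<in> Hom D x (Dom D (Cpt k a))" "Cpt k a \<odot>\<^bsub>D\<^esub> u = h" using kd(4) by blast
    then show "zero_arrow D h" using D.zero_arrow_pre[OF z kd(2)] by blast
  qed
qed

lemma factors_through_fcD:
  assumes "factors_through (functor_category C D) g k" "is_nat_trans C D g" "is_nat_trans C D k" "a \<in> Obj C"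
  shows "factors_through D (Cpt g a) (Cpt k a)"
proof -
  obtain u where u: "is_nat_trans C D u" "Src u = Src g" "Tgt u = Src k" "k \<odot>\<^bsub>functor_category C D\<^esub> u = g"
    using assms(1) by (auto simp: factors_through_def Hom_fc fc_sel(3))
  then have "Cpt k a \<odot>\<^bsub>D\<^esub> Cpt u a = Cpt g a" using Cpt_comp[OF assms(4)] by metis
  moreover have "Cpt u a \<in> Hom D (Dom D (Cpt g a)) (Dom D (Cpt k a))"
    using is_nat_transD(3)[OF u(1) assms(4)] is_nat_transD(3)[OF assms(2,4)] is_nat_transD(3)[OF assms(3,4)] u(2,3)
    by (simp add: Hom_def)
  ultimately show ?thesis by (auto simp: factors_through_def)
qed

text \<open>Any kernel and the componentwise one from \<open>ex_kernel_fc\<close> factor through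
  each other. Both factorisations restrict to components, where \<open>kernel_equiv\<close>
  applies.\<close>

lemma is_kernel_fcD:
  assumes "category C" "abelian_category D" "is_kernel (functor_category C D) k t" "a \<in> Obj C"
  shows "is_kernel D (Cpt k a) (Cpt t a)"
proof -
  interpret D: abelian_category D by fact
  let ?F = "functor_category C D"
  interpret F: category ?F using category_fc assms(1) D.category_axioms .
  have nt: "is_nat_trans C D t" "is_nat_trans C D k" "Tgt k = Src t" using assms(3) by (simp_all add: is_kernel_def fc_sel)
  obtain k' where k': "is_kernel ?F k' t" "is_kernel D (Cpt k' a) (Cpt t a)"
    using ex_kernel_fc[OF assms(1,2) nt(1)] assms(4) by blast
  have nt': "is_nat_trans C D k'" using k' by (simp add: is_kernel_def fc_sel)
  have ft: "factors_through ?F k k'" "factors_through ?F k' k"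
    using is_kernelD[OF assms(3)] is_kernelD[OF k'(1)] by (auto simp: factors_through_def)
  have "factors_through D (Cpt k a) (Cpt k' a)" "factors_through D (Cpt k' a) (Cpt k a)"
    using factors_through_fcD[OF ft(1) nt(2) nt' assms(4)] factors_through_fcD[OF ft(2) nt' nt(2) assms(4)] .
  moreover have "Cod D (Cpt k a) = Dom D (Cpt t a)"
    using is_nat_transD(3)[OF nt(1) assms(4)] is_nat_transD(3)[OF nt(2) assms(4)] nt(3) by (simp add: Hom_def)
  ultimately show ?thesis
    using D.kernel_equiv[OF k'(2)] monic_fcD[OF assms(1,2) F.kernel_monic[OF assms(3)] assms(4)] by blast
qed

text \<open>\<open>ex_cokernel_fc\<close> states existence and hides the components of what it
  builds; dualising the result on kernels describes them for every cokernel.\<close>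

lemma is_cokernel_fcD:
  assumes "category C" "abelian_category D" "is_cokernel (functor_category C D) c t" "a \<in> Obj C"
  shows "is_cokernel D (Cpt c a) (Cpt t a)"
  using is_kernel_fcD[OF category_op[OF assms(1)] abelian_category_op[OF assms(2)], of "op_nat_trans c" "op_nat_trans t" a]
    assms(3,4) by (simp add: is_kernel_fc_op is_kernel_op op_nt_sel op_sel)

text \<open>Normality is checked on components: there \<open>t\<close> is monic, hence normal in
  \<open>D\<close>, hence the kernel of its own cokernel, which is the component of
  \<open>c\<close>.\<close>

lemma monic_normal_fc:
  assumes "category C" "abelian_category D" "monic (functor_category C D) t"
    "is_cokernel (functor_category C D) c t"
  shows "is_kernel (functor_category C D) t c"
proof (rule is_kernel_fcI[OF assms(1,2)])
  interpret D: abelian_category D by fact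
  show "is_nat_trans C D t" "is_nat_trans C D c" "Tgt t = Src c"
    using assms(4) by (simp_all add: is_cokernel_def fc_sel)
  fix a assume a: "a \<in> Obj C"
  obtain f where "is_kernel D (Cpt t a) f" using D.monic_normal[OF monic_fcD[OF assms(1-3) a]] by blast
  then show "is_kernel D (Cpt t a) (Cpt c a)"
    using D.kernel_of_cokernel is_cokernel_fcD[OF assms(1,2,4) a] by blast
qed

lemma epic_normal_fc:
  assumes "category C" "abelian_category D" "epic (functor_category C D) e"
    "is_kernel (functor_category C D) k e"
  shows "is_cokernel (functor_category C D) e k"
  using monic_normal_fc[OF category_op[OF assms(1)] abelian_category_op[OF assms(2)] monic_op[OF assms(3)],
      of "op_nat_trans k"] assms(4) by (simp add: is_kernel_fc_op is_cokernel_fc_op)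


section \<open>Whiskering and invertible transformations\<close>

lemma id_functor_sel:
  "a \<in> Obj C \<Longrightarrow> FObj (id_functor C) a = a" "f \<in> Arr C \<Longrightarrow> FArr (id_functor C) f = f"
  by (simp_all add: id_functor_def)

lemma is_functor_comp:
  assumes "category C" "is_functor C D F" "is_functor D E G"
  shows "is_functor C E (comp_functor C G F)"
proof -
  interpret C: category C by fact
  note F = is_functorD[OF assms(2)] and G = is_functorD[OF assms(3)]
  have FA: "FArr F f \<in> Arr D" if "f \<in> Arr C" for f using F(2)[OF HomI[OF that]] by (simp add: Hom_def)
  have GA: "FArr G f \<in> Arr E" if "f \<in> Arr D" for f using G(2)[OF HomI[OF that]] by (simp add: Hom_def)
  show ?thesis unfolding is_functor_def
  proof (intro conjI ballI impI)
    show "FArr (comp_functor C G F) (g \<odot>\<^bsub>C\<^esub> f) = FArr (comp_functor C G F) g \<odot>\<^bsub>E\<^esub> FArr (comp_functor C G F) f"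
      if "f \<in> Arr C" "g \<in> Arr C" "Dom C g = Cod C f" for f g
    proof -
      note fg = HomI[OF that(1)] HomI[OF that(2), unfolded that(3)]
      show ?thesis
        using F(4)[OF fg] G(4)[OF F(2)[OF fg(1)] F(2)[OF fg(2)]] HomD[OF C.Comp_Hom[OF fg]] that
        by (simp add: comp_functor_def compose_def)
    qed
  qed (use F(1,3) G(1,3) FA GA F(2)[OF HomI] G(2) C.Dom_Obj C.Cod_Obj HomD[OF C.Id_Hom] in
      \<open>simp_all add: comp_functor_def compose_def\<close>)
qed

text \<open>An equality rather than an isomorphism, thanks to extensionality. It makes
  \<open>whisker C t S\<close> end in \<open>S\<close> itself when \<open>t\<close> ends in the
  identity functor, so that it can be composed with \<open>s\<close>.\<close>

lemma comp_functor_id: "is_functor C D F \<Longrightarrow> comp_functor C (id_functor D) F = F"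
  by (cases F) (auto simp: comp_functor_def id_functor_def is_functor_def compose_def PiE_def
      intro!: extensionalityI[of _ "Obj C"] extensionalityI[of _ "Arr C"])

lemma Cpt_whisker: "a \<in> Obj C \<Longrightarrow> Cpt (whisker C t S) a = Cpt t (FObj S a)"
  by (simp add: whisker_def compose_def)

lemma whisker_Hom:
  assumes "category C" "is_functor C D S" "is_nat_trans D E t"
  shows "whisker C t S \<in> Hom (functor_category C E) (comp_functor C (Src t) S) (comp_functor C (Tgt t) S)"
proof -
  interpret C: category C by fact
  note t = is_nat_transD[OF assms(3)] and S = is_functorD[OF assms(2)]
  have "is_nat_trans C E (whisker C t S)" unfolding is_nat_trans_def
    using is_functor_comp[OF assms(1,2) t(1)] is_functor_comp[OF assms(1,2) t(2)]
      t(3)[OF S(1)] t(4)[OF S(2)[OF HomI]] C.Dom_Obj C.Cod_Obj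
    by (simp add: whisker_def comp_functor_def compose_def)
  then show ?thesis by (simp add: Hom_fc whisker_def)
qed

lemma functor_invertible:
  assumes "is_functor C D F" "category C" "invertible C f"
  shows "invertible D (FArr F f)"
proof -
  interpret C: category C by fact
  note F = is_functorD[OF assms(1)]
  have f: "f \<in> Hom C (Dom C f) (Cod C f)" using assms(3) by (simp add: invertible_def HomI)
  obtain g where g: "g \<in> Hom C (Cod C f) (Dom C f)" "g \<odot>\<^bsub>C\<^esub> f = Id C (Dom C f)" "f \<odot>\<^bsub>C\<^esub> g = Id C (Cod C f)"
    using invertibleE[OF assms(3) f] .
  show ?thesis
    using invertibleI[OF F(2)[OF f] F(2)[OF g(1)]] F(4)[OF f g(1)] F(4)[OF g(1) f] F(3)[OF C.Hom_Obj(1)[OF f]]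
      F(3)[OF C.Hom_Obj(2)[OF f]] g(2,3) by simp
qed

lemma invertible_fcD:
  assumes "invertible (functor_category C D) t" "a \<in> Obj C"
  shows "invertible D (Cpt t a)"
proof -
  let ?F = "functor_category C D"
  have t: "t \<in> Hom ?F (Src t) (Tgt t)" using assms(1) by (simp add: invertible_def Hom_fc fc_sel)
  obtain u where u: "u \<in> Hom ?F (Tgt t) (Src t)" "u \<odot>\<^bsub>?F\<^esub> t = Id ?F (Src t)" "t \<odot>\<^bsub>?F\<^esub> u = Id ?F (Tgt t)"
    using invertibleE[OF assms(1) t] .
  have Id: "Cpt (Id ?F G) a = Id D (FObj G a)" for G using assms(2) by (simp add: fc_sel)
  have "Cpt u a \<in> Hom D (FObj (Tgt t) a) (FObj (Src t) a)" "Cpt t a \<in> Hom D (FObj (Src t) a) (FObj (Tgt t) a)"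
    using is_nat_transD(3)[of C D u a] is_nat_transD(3)[of C D t a] t u(1) assms(2) by (simp_all add: Hom_fc)
  moreover have "Cpt u a \<odot>\<^bsub>D\<^esub> Cpt t a = Id D (FObj (Src t) a)" "Cpt t a \<odot>\<^bsub>D\<^esub> Cpt u a = Id D (FObj (Tgt t) a)"
    using arg_cong[OF u(2), of "\<lambda>x. Cpt x a"] arg_cong[OF u(3), of "\<lambda>x. Cpt x a"]
    unfolding Cpt_comp[OF assms(2)] Id .
  ultimately show ?thesis using invertibleI by metis
qed

lemma invertible_fcI:
  assumes "category C" "category D" "is_nat_trans C D t" "\<And>a. a \<in> Obj C \<Longrightarrow> invertible D (Cpt t a)"
  shows "invertible (functor_category C D) t"
proof -
  let ?F = "functor_category C D"
  interpret D: category D by fact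
  interpret F: category ?F using category_fc assms(1,2) .
  have t: "t \<in> Hom ?F (Src t) (Tgt t)" using assms(3) by (simp add: Hom_fc)
  have mono: "monic D (Cpt t a)" if "a \<in> Obj C" for a using D.invertible_monic assms(4)[OF that] .
  have i: "Id ?F (Tgt t) \<in> Hom ?F (Tgt t) (Tgt t)" using F.Id_Hom F.Hom_Obj[OF t] by blast
  \<comment> \<open>Pointwise inverses are factorisations of identities through the components of
    \<open>t\<close>; naturality of the resulting family comes from
    \<open>factors_through_fcI\<close>.\<close>
  have "factors_through ?F (Id ?F (Tgt t)) t"
  proof (rule factors_through_fcI[OF assms(1-3) _ _ mono])
    show "is_nat_trans C D (Id ?F (Tgt t))" "Tgt (Id ?F (Tgt t)) = Tgt t" using i by (simp_all add: Hom_fc)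
    fix a assume a: "a \<in> Obj C"
    note ta = is_nat_transD(3)[OF assms(3) a]
    obtain g where "g \<in> Hom D (FObj (Tgt t) a) (FObj (Src t) a)" "Cpt t a \<odot>\<^bsub>D\<^esub> g = Id D (FObj (Tgt t) a)"
      using invertibleE[OF assms(4)[OF a] ta] .
    moreover have "Cpt (Id ?F (Tgt t)) a = Id D (FObj (Tgt t) a)" using a by (simp add: fc_sel)
    moreover have "Dom D (Id D (FObj (Tgt t) a)) = FObj (Tgt t) a" "Dom D (Cpt t a) = FObj (Src t) a"
      using D.Id_Hom[OF D.Hom_Obj(2)[OF ta]] ta by (simp_all add: Hom_def)
    ultimately show "factors_through D (Cpt (Id ?F (Tgt t)) a) (Cpt t a)" by (auto simp: factors_through_def)
  qed
  then obtain u where "u \<in> Hom ?F (Tgt t) (Src t)" "t \<odot>\<^bsub>?F\<^esub> u = Id ?F (Tgt t)"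
    using i by (auto simp: factors_through_def Hom_fc fc_sel(3))
  then show ?thesis using F.monic_right_inverse[OF monic_fcI[OF assms(3) mono] t] by blast
qed

section \<open>Classes of preradicals\<close>

context category
begin

lemma factors_through_refl: "m \<in> Arr C \<Longrightarrow> factors_through C m m"
  unfolding factors_through_def using Id_Hom Dom_Obj Comp_Id HomI by metis

lemma factors_through_trans:
  assumes "factors_through C k m" "factors_through C m n" "n \<in> Arr C"
  shows "factors_through C k n"
proof -
  obtain u where u: "u \<in> Hom C (Dom C k) (Dom C m)" "m \<odot> u = k" using assms(1) by (auto simp: factors_through_def)
  obtain v where v: "v \<in> Hom C (Dom C m) (Dom C n)" "n \<odot> v = m" using assms(2) by (auto simp: factors_through_def)
  have "n \<odot> (v \<odot> u) = k" using Comp_assoc[OF u(1) v(1) HomI[OF assms(3)]] u(2) v(2) by simp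
  then show ?thesis using Comp_Hom[OF u(1) v(1)] by (auto simp: factors_through_def)
qed

lemma equiv_sub_equiv: "equiv (monics_into C x) (sub_equiv C x)"
proof (rule equivI)
  have arr: "m \<in> Arr C" if "m \<in> monics_into C x" for m using that by (simp add: monics_into_def monic_def)
  show "sub_equiv C x \<subseteq> monics_into C x \<times> monics_into C x" by (auto simp: sub_equiv_def)
  show "refl_on (monics_into C x) (sub_equiv C x)"
    by (rule refl_onI) (auto simp: sub_equiv_def intro: factors_through_refl arr)
  show "sym (sub_equiv C x)" by (rule symI) (auto simp: sub_equiv_def)
  show "trans (sub_equiv C x)"
    by (rule transI) (auto simp: sub_equiv_def intro: factors_through_trans arr)
qed

text \<open>Turns equivalence of subobjects into an isomorphism of their sources: cancelling
  \<open>n\<close> in \<open>n \<odot> (u \<odot> v) = n\<close> gives a right inverse, and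
  \<open>u\<close> is monic because \<open>n \<odot> u\<close> is.\<close>

lemma mutually_factoring_monics:
  assumes "monic C m" "monic C n" "Cod C m = Cod C n" "factors_through C m n" "factors_through C n m"
  obtains u where "u \<in> Hom C (Dom C m) (Dom C n)" "invertible C u" "n \<odot> u = m"
proof -
  have m: "m \<in> Hom C (Dom C m) (Cod C n)" and n: "n \<in> Hom C (Dom C n) (Cod C n)"
    using assms(1-3) by (simp_all add: monic_def Hom_def)
  obtain u where u: "u \<in> Hom C (Dom C m) (Dom C n)" "n \<odot> u = m" using assms(4) by (auto simp: factors_through_def)
  obtain v where v: "v \<in> Hom C (Dom C n) (Dom C m)" "m \<odot> v = n" using assms(5) by (auto simp: factors_through_def)
  have "n \<odot> (u \<odot> v) = n \<odot> Id C (Dom C n)"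
    using Comp_assoc[OF v(1) u(1) n] u(2) v(2) Comp_Id[OF n] by simp
  then have "u \<odot> v = Id C (Dom C n)"
    using monicD[OF assms(2) n Comp_Hom[OF v(1) u(1)] Id_Hom[OF Hom_Obj(1)[OF n]]] by simp
  moreover have "monic C u" using monic_cancel[OF _ u(1) n] u(2) assms(1) by simp
  ultimately show thesis using that u monic_right_inverse[OF _ u(1) v(1)] by blast
qed

lemma pullbacks_factor:
  assumes "is_pullback C f g p q" "is_pullback C f g p' q'"
  shows "factors_through C p p'"
  using is_pullbackD(6)[OF assms(2) is_pullbackD(3,4,5)[OF assms(1)]]
  by (auto simp: factors_through_def)

lemma zero_arrow_conjugate:
  assumes "zero_arrow C f" "invertible C h" "f \<in> Hom C a b" "h \<in> Hom C a a'"
    "k \<in> Hom C b b'" "f' \<in> Hom C a' b'" "f' \<odot> h = k \<odot> f"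
  shows "zero_arrow C f'"
proof -
  obtain h' where h': "h' \<in> Hom C a' a" "h' \<odot> h = Id C a" "h \<odot> h' = Id C a'"
    using invertibleE[OF assms(2,4)] .
  have "f' = (k \<odot> f) \<odot> h'" using Comp_assoc[OF h'(1) assms(4,6)] Comp_Id assms(6,7) h'(3) by simp
  then show ?thesis
    using zero_arrow_pre[OF zero_arrow_post[OF assms(1,3,5)] Comp_Hom[OF assms(3,5)] h'(1)] by simp
qed

section \<open>Representatives of preradicals\<close>

lemma Pr_arrow:
  assumes "\<tau> \<in> Pr C" "t \<in> \<tau>"
  shows "monic (functor_category C C) t" "is_nat_trans C C t" "Tgt t = id_functor C"
proof -
  let ?F = "functor_category C C"
  interpret F: category ?F using category_fc category_axioms category_axioms .
  have "t \<in> monics_into ?F (id_functor C)"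
    using in_quotient_imp_subset[OF F.equiv_sub_equiv] assms unfolding Pr_def subobjects_def by blast
  then show "monic ?F t" "is_nat_trans C C t" "Tgt t = id_functor C"
    by (simp_all add: monics_into_def monic_def fc_sel)
qed

lemma Pr_eq_pr_class:
  assumes "\<tau> \<in> Pr C" "t \<in> \<tau>"
  shows "\<tau> = pr_class C t"
proof -
  let ?F = "functor_category C C"
  interpret F: category ?F using category_fc category_axioms category_axioms .
  obtain s where "s \<in> monics_into ?F (id_functor C)" "\<tau> = sub_equiv ?F (id_functor C) `` {s}"
    using assms(1) by (auto simp: Pr_def subobjects_def elim: quotientE)
  with assms(2) show ?thesis using equiv_class_eq[OF F.equiv_sub_equiv] unfolding pr_class_def by blast
qed

lemma Pr_nonempty: "\<tau> \<in> Pr C \<Longrightarrow> \<exists>t. t \<in> \<tau>"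
proof -
  let ?F = "functor_category C C"
  interpret F: category ?F using category_fc category_axioms category_axioms .
  show "\<tau> \<in> Pr C \<Longrightarrow> \<exists>t. t \<in> \<tau>"
    using in_quotient_imp_non_empty[OF F.equiv_sub_equiv] unfolding Pr_def subobjects_def by blast
qed

lemma Pr_mem_iff:
  assumes "\<tau> \<in> Pr C" "t \<in> \<tau>"
  shows "p \<in> \<tau> \<longleftrightarrow> monic (functor_category C C) p \<and> Tgt p = id_functor C \<and>
     factors_through (functor_category C C) p t \<and> factors_through (functor_category C C) t p"
  using Pr_eq_pr_class[OF assms] Pr_arrow[OF assms]
  by (auto simp: pr_class_def sub_equiv_def monics_into_def fc_sel)

text \<open>Each class of a member of \<open>X\<close> is \<open>\<tau>\<close> itself. The witness
  \<open>x\<close> keeps the union from being empty.\<close>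

lemma Union_pr_classI:
  assumes "\<tau> \<in> Pr C" "X \<subseteq> \<tau>" "x \<in> X"
  shows "\<Union> (pr_class C ` X) = \<tau>"
  using Pr_eq_pr_class[OF assms(1)] assms(2,3) by blast

text \<open>A member \<open>t\<close> of the union lies in the class of some \<open>x\<close>, and
  by symmetry \<open>x\<close> lies in the class of \<open>t\<close>. In particular this
  \<open>x\<close> is monic, as the class of a non-monic arrow is empty.\<close>

lemma Union_pr_classD:
  assumes "\<tau> \<in> Pr C" "\<Union> (pr_class C ` X) = \<tau>"
  shows "\<exists>x \<in> X. x \<in> \<tau>"
proof -
  obtain t where t: "t \<in> \<tau>" using Pr_nonempty[OF assms(1)] by blast
  then obtain x where x: "x \<in> X" "t \<in> pr_class C x" using assms(2) by blast
  let ?F = "functor_category C C"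
  interpret F: category ?F using category_fc category_axioms category_axioms .
  have "x \<in> pr_class C t" using x(2) by (simp add: pr_class_def sub_equiv_def)
  then show ?thesis using x(1) Pr_eq_pr_class[OF assms(1) t] by blast
qed

lemma Pr_naturality:
  assumes "\<tau> \<in> Pr C" "t \<in> \<tau>"
  shows "x \<in> Obj C \<Longrightarrow> Cpt t x \<in> Hom C (FObj (Src t) x) x"
    "b \<in> Hom C x y \<Longrightarrow> FArr (Src t) b \<in> Hom C (FObj (Src t) x) (FObj (Src t) y)"
    "b \<in> Hom C x y \<Longrightarrow> Cpt t y \<odot> FArr (Src t) b = b \<odot> Cpt t x"
  using is_nat_transD[OF Pr_arrow(2)[OF assms]] Pr_arrow(3)[OF assms] is_functorD(2)
    id_functor_sel HomD[of b C x y] by (metis+)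

text \<open>Invertibility and vanishing of \<open>t\<^bsub>x\<^esub>\<close> depend neither on the representative \<open>t\<close> of a
  preradical nor on the choice of \<open>x\<close> within its isomorphism class.\<close>

lemma Pr_component_transfer:
  assumes "\<tau> \<in> Pr C" "t \<in> \<tau>" "t' \<in> \<tau>" "b \<in> Hom C x y" "invertible C b"
  shows "invertible C (Cpt t x) \<Longrightarrow> invertible C (Cpt t' y)"
    "zero_arrow C (Cpt t x) \<Longrightarrow> zero_arrow C (Cpt t' y)"
proof -
  let ?F = "functor_category C C"
  interpret F: category ?F using category_fc category_axioms category_axioms .
  have o: "x \<in> Obj C" "y \<in> Obj C" using Hom_Obj[OF assms(4)] .
  obtain u where u: "u \<in> Hom ?F (Src t) (Src t')" "invertible ?F u" "t' \<odot>\<^bsub>?F\<^esub> u = t"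
    using F.mutually_factoring_monics[of t t'] Pr_arrow[OF assms(1,2)] Pr_arrow[OF assms(1,3)]
      Pr_mem_iff[OF assms(1,2), of t'] assms(3) by (auto simp: fc_sel)
  have uy: "Cpt u y \<in> Hom C (FObj (Src t) y) (FObj (Src t') y)"
    using is_nat_transD(3)[of C C u y] u(1) o(2) by (simp add: Hom_fc)
  have e: "Cpt t' y \<odot> Cpt u y = Cpt t y" using Cpt_comp[OF o(2)] u(3) by metis
  note n = Pr_naturality[OF assms(1,2)] and n' = Pr_naturality[OF assms(1,3)]
  \<comment> \<open>The isomorphism on the source side of the square: move along \<open>b\<close>
    inside \<open>Src t\<close>, then change the representative by \<open>u\<close>.\<close>
  have h: "Cpt u y \<odot> FArr (Src t) b \<in> Hom C (FObj (Src t) x) (FObj (Src t') y)"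
    using Comp_Hom[OF n(2)[OF assms(4)] uy] .
  have inv: "invertible C (Cpt u y \<odot> FArr (Src t) b)"
    using invertible_comp[OF functor_invertible invertible_fcD[OF u(2) o(2)] n(2)[OF assms(4)] uy]
      is_nat_transD(1)[OF Pr_arrow(2)[OF assms(1,2)]] category_axioms assms(5) by blast
  have eq: "Cpt t' y \<odot> (Cpt u y \<odot> FArr (Src t) b) = b \<odot> Cpt t x"
    using Comp_assoc[OF n(2)[OF assms(4)] uy n'(1)[OF o(2)]] e n(3)[OF assms(4)] by simp
  show "invertible C (Cpt t x) \<Longrightarrow> invertible C (Cpt t' y)"
    using invertible_conjugate[OF _ inv assms(5) n(1)[OF o(1)] h assms(4) n'(1)[OF o(2)] eq] .
  show "zero_arrow C (Cpt t x) \<Longrightarrow> zero_arrow C (Cpt t' y)"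
    using zero_arrow_conjugate[OF _ inv n(1)[OF o(1)] h assms(4) n'(1)[OF o(2)] eq] .
qed

end

section \<open>Componentwise criteria\<close>

text \<open>The equation says that \<open>s\<close> and its composite with the whiskered
  \<open>r\<close> are equivalent. As \<open>s\<close> is monic and cancels, this amounts to
  invertibility of the whiskered \<open>r\<close>, which is tested on components.\<close>

lemma (in category) pr_idempotent_iff:
  assumes "\<tau> \<in> Pr C" "t \<in> \<tau>"
  shows "pr_idempotent C \<tau> \<longleftrightarrow> (\<forall>a \<in> Obj C. invertible C (Cpt t (FObj (Src t) a)))"
proof -
  let ?F = "functor_category C C"
  interpret F: category ?F using category_fc category_axioms category_axioms .
  define X where "X = {s \<odot>\<^bsub>?F\<^esub> whisker C r (Src s) | r s. r \<in> \<tau> \<and> s \<in> \<tau>}"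
  have prod: "pr_product C \<tau> \<tau> = \<Union> (pr_class C ` X)" unfolding pr_product_def X_def
    by (rule arg_cong[of _ _ Union]) blast
  have wh: "whisker C r (Src s) \<in> Hom ?F (comp_functor C (Src r) (Src s)) (Src s)" and
    s: "s \<in> Hom ?F (Src s) (id_functor C)" if rs: "r \<in> \<tau>" "s \<in> \<tau>" for r s
    using whisker_Hom[OF category_axioms is_nat_transD(1)[OF Pr_arrow(2)[OF assms(1) rs(2)]] Pr_arrow(2)[OF assms(1) rs(1)]]
      comp_functor_id[OF is_nat_transD(1)[OF Pr_arrow(2)[OF assms(1) rs(2)]]] Pr_arrow[OF assms(1)] rs
    by (simp_all add: Hom_fc)
  \<comment> \<open>The union allows different representatives \<open>r\<close> and
    \<open>s\<close>; both may be exchanged, since \<open>Src s\<close> and \<open>Src s'\<close>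
    are isomorphic.\<close>
  have transfer: "invertible C (Cpt r' (FObj (Src s') a))"
    if rs: "r \<in> \<tau>" "s \<in> \<tau>" "r' \<in> \<tau>" "s' \<in> \<tau>" and a: "a \<in> Obj C" and i: "invertible C (Cpt r (FObj (Src s) a))"
    for r s r' s' a
  proof -
    obtain u where u: "u \<in> Hom ?F (Src s) (Src s')" "invertible ?F u"
      using F.mutually_factoring_monics[of s s'] Pr_arrow[OF assms(1) rs(2)] Pr_arrow[OF assms(1) rs(4)]
        Pr_mem_iff[OF assms(1) rs(2), of s'] rs(4) by (auto simp: fc_sel)
    have "Cpt u a \<in> Hom C (FObj (Src s) a) (FObj (Src s') a)"
      using is_nat_transD(3)[of C C u a] u(1) a by (simp add: Hom_fc)
    then show ?thesis using Pr_component_transfer(1)[OF assms(1) rs(1,3) _ invertible_fcD[OF u(2) a] i] by blast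
  qed
  show ?thesis
  proof
    assume "pr_idempotent C \<tau>"
    then obtain r s where rs: "r \<in> \<tau>" "s \<in> \<tau>" and p: "s \<odot>\<^bsub>?F\<^esub> whisker C r (Src s) \<in> \<tau>"
      using Union_pr_classD[OF assms(1), of X] unfolding pr_idempotent_def prod X_def by blast
    note w = wh[OF rs] and s = s[OF rs]
    have d: "Src (s \<odot>\<^bsub>?F\<^esub> whisker C r (Src s)) = comp_functor C (Src r) (Src s)"
      using F.Comp_Hom[OF w s] by (simp add: Hom_fc)
    \<comment> \<open>The composite is monic because it belongs to \<open>\<tau>\<close>, and its
      first factor inherits this.\<close>
    have mono: "monic ?F (whisker C r (Src s))" using F.monic_cancel[OF Pr_arrow(1)[OF assms(1) p] w s] .
    have "factors_through ?F s (s \<odot>\<^bsub>?F\<^esub> whisker C r (Src s))" using Pr_mem_iff[OF assms(1) rs(2)] p by blast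
    then obtain u where u: "u \<in> Hom ?F (Src s) (comp_functor C (Src r) (Src s))"
      "(s \<odot>\<^bsub>?F\<^esub> whisker C r (Src s)) \<odot>\<^bsub>?F\<^esub> u = s"
      unfolding factors_through_def fc_sel(3) d by blast
    have i: "Id ?F (Src s) \<in> Hom ?F (Src s) (Src s)" using F.Id_Hom F.Hom_Obj(1)[OF s] .
    have "s \<odot>\<^bsub>?F\<^esub> (whisker C r (Src s) \<odot>\<^bsub>?F\<^esub> u) = s \<odot>\<^bsub>?F\<^esub> Id ?F (Src s)"
      using F.Comp_assoc[OF u(1) w s] u(2) F.Comp_Id[OF s] by simp
    then have "whisker C r (Src s) \<odot>\<^bsub>?F\<^esub> u = Id ?F (Src s)"
      using monicD[OF Pr_arrow(1)[OF assms(1) rs(2)] s F.Comp_Hom[OF u(1) w] i] by blast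
    then have "invertible ?F (whisker C r (Src s))" using F.monic_right_inverse[OF mono w u(1)] by blast
    then have "invertible C (Cpt r (FObj (Src s) a))" if "a \<in> Obj C" for a
      using invertible_fcD[OF _ that] Cpt_whisker[OF that] by metis
    then show "\<forall>a \<in> Obj C. invertible C (Cpt t (FObj (Src t) a))" using transfer[OF rs assms(2,2)] by blast
  next
    assume inv: "\<forall>a \<in> Obj C. invertible C (Cpt t (FObj (Src t) a))"
    have "s \<odot>\<^bsub>?F\<^esub> whisker C r (Src s) \<in> \<tau>" if rs: "r \<in> \<tau>" "s \<in> \<tau>" for r s
    proof -
      note w = wh[OF rs] and s = s[OF rs]
      have "invertible C (Cpt (whisker C r (Src s)) a)" if "a \<in> Obj C" for a
        using transfer[OF assms(2,2) rs that] inv that Cpt_whisker[OF that] by metis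
      then have i: "invertible ?F (whisker C r (Src s))"
        using invertible_fcI[OF category_axioms category_axioms] w by (simp add: Hom_fc)
      obtain u where u: "u \<in> Hom ?F (Src s) (comp_functor C (Src r) (Src s))"
        "whisker C r (Src s) \<odot>\<^bsub>?F\<^esub> u = Id ?F (Src s)" using invertibleE[OF i w] .
      note sw = F.Comp_Hom[OF w s]
      have "(s \<odot>\<^bsub>?F\<^esub> whisker C r (Src s)) \<odot>\<^bsub>?F\<^esub> u = s"
        using F.Comp_assoc[OF u(1) w s] u(2) F.Comp_Id[OF s] by simp
      then have "factors_through ?F s (s \<odot>\<^bsub>?F\<^esub> whisker C r (Src s))"
        using HomD[OF sw] HomD[OF s] u(1) by (auto simp: factors_through_def)
      moreover have "factors_through ?F (s \<odot>\<^bsub>?F\<^esub> whisker C r (Src s)) s"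
        using HomD[OF sw] HomD[OF s] w by (auto simp: factors_through_def)
      moreover have "monic ?F (s \<odot>\<^bsub>?F\<^esub> whisker C r (Src s))"
        using F.monic_comp[OF F.invertible_monic[OF i] Pr_arrow(1)[OF assms(1) rs(2)] w s] .
      ultimately show ?thesis using Pr_mem_iff[OF assms(1) rs(2)] sw by (simp add: Hom_fc)
    qed
    then have "X \<subseteq> \<tau>" "t \<odot>\<^bsub>?F\<^esub> whisker C t (Src t) \<in> X" using assms(2) by (auto simp: X_def)
    then show "pr_idempotent C \<tau>" using Union_pr_classI[OF assms(1)] unfolding pr_idempotent_def prod by blast
  qed
qed

lemma (in abelian_category) pr_radical_iff_zero:
  assumes "\<tau> \<in> Pr C" "t \<in> \<tau>" "is_cokernel (functor_category C C) c t"
  shows "pr_radical C \<tau> \<longleftrightarrow> (\<forall>a \<in> Obj C. zero_arrow C (Cpt t (FObj (Tgt c) a)))"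
proof -
  let ?F = "functor_category C C"
  note cat = category_axioms and ab = abelian_category_axioms
  interpret F: category ?F using category_fc cat cat .
  obtain z where z: "zero_object C z" using ex_zero_object by blast
  define X where "X = {p. \<exists>q s r d. s \<in> \<tau> \<and> r \<in> \<tau> \<and> is_cokernel ?F d s \<and>
    is_pullback ?F d (whisker C r (Tgt d)) p q}"
  have coprod: "pr_coproduct C \<tau> \<tau> = \<Union> (pr_class C ` X)" unfolding pr_coproduct_def X_def
    by (rule arg_cong[of _ _ Union]) blast
  have cok: "d \<in> Hom ?F (id_functor C) (Tgt d)" if "is_cokernel ?F d s" "s \<in> \<tau>" for d s
    using is_cokernelD(2)[OF that(1)] Pr_arrow(3)[OF assms(1) that(2)] by (simp add: fc_sel(4))
  have wh: "whisker C r (Tgt d) \<in> Hom ?F (comp_functor C (Src r) (Tgt d)) (Tgt d)"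
    "monic ?F (whisker C r (Tgt d))"
    if rs: "is_cokernel ?F d s" "s \<in> \<tau>" "r \<in> \<tau>" for r s d
  proof -
    have D: "is_functor C C (Tgt d)" using cok[OF rs(1,2)] by (auto simp: Hom_fc is_nat_trans_def)
    show w: "whisker C r (Tgt d) \<in> Hom ?F (comp_functor C (Src r) (Tgt d)) (Tgt d)"
      using whisker_Hom[OF cat D Pr_arrow(2)[OF assms(1) rs(3)]] comp_functor_id[OF D] Pr_arrow(3)[OF assms(1) rs(3)]
      by simp
    \<comment> \<open>The components of the whiskered transformation are components of
      \<open>r\<close>, and these are monic by \<open>monic_fcD\<close>.\<close>
    show "monic ?F (whisker C r (Tgt d))"
      using monic_fcI[of C C "whisker C r (Tgt d)"] w Cpt_whisker[of _ C r "Tgt d"]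
        monic_fcD[OF cat ab Pr_arrow(1)[OF assms(1) rs(3)]] is_functorD(1)[OF D]
      by (simp add: Hom_fc)
  qed
  have transfer: "zero_arrow C (Cpt r' (FObj (Tgt d') a))"
    if rs: "is_cokernel ?F d s" "s \<in> \<tau>" "r \<in> \<tau>" "is_cokernel ?F d' s'" "s' \<in> \<tau>" "r' \<in> \<tau>"
      and a: "a \<in> Obj C" and i: "zero_arrow C (Cpt r (FObj (Tgt d) a))"
    for d s r d' s' r' a
  proof -
    \<comment> \<open>Cokernels of equivalent monics are epics factoring through each other. Read in
      \<open>op_cat ?F\<close> they are mutually factoring monics, which yields an isomorphism
      between their targets.\<close>
    interpret op: category "op_cat ?F" using category_op F.category_axioms .
    have ft: "factors_through ?F s s'" "factors_through ?F s' s" using Pr_mem_iff[OF assms(1) rs(2), of s'] rs(5) by auto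
    have cd: "Cod ?F s = Cod ?F s'" using Pr_arrow(3)[OF assms(1)] rs by (simp add: fc_sel)
    have "factors_through (op_cat ?F) d' d" "factors_through (op_cat ?F) d d'"
      using F.cokernels_factor[OF rs(1,4) ft(1) cd] F.cokernels_factor[OF rs(4,1) ft(2) cd[symmetric]]
      by (auto simp: factors_through_def op_sel)
    then obtain u where u: "u \<in> Hom ?F (Tgt d) (Tgt d')" "invertible ?F u"
      using op.mutually_factoring_monics[of d' d] F.cokernel_epic[OF rs(1)] F.cokernel_epic[OF rs(4)]
        cok[OF rs(1,2)] cok[OF rs(4,5)]
      by (auto simp: monic_op_cat invertible_op op_sel fc_sel(3,4) Hom_fc)
    have "Cpt u a \<in> Hom C (FObj (Tgt d) a) (FObj (Tgt d') a)"
      using is_nat_transD(3)[of C C u a] u(1) a by (simp add: Hom_fc)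
    then show ?thesis using Pr_component_transfer(2)[OF assms(1) rs(3,6) _ invertible_fcD[OF u(2) a] i] by blast
  qed
  have wz: "zero_arrow ?F (whisker C r (Tgt d)) \<longleftrightarrow> (\<forall>a \<in> Obj C. zero_arrow C (Cpt r (FObj (Tgt d) a)))"
    if rs: "is_cokernel ?F d s" "s \<in> \<tau>" "r \<in> \<tau>" for r s d
    using zero_arrow_fc[OF cat cat z, of "whisker C r (Tgt d)"] wh(1)[OF rs] Cpt_whisker[of _ C r "Tgt d"]
    by (simp add: Hom_fc)
  show ?thesis
  proof
    assume "pr_radical C \<tau>"
    then obtain p q s r d where rs: "is_cokernel ?F d s" "s \<in> \<tau>" "r \<in> \<tau>"
      and pb: "is_pullback ?F d (whisker C r (Tgt d)) p q" and p: "p \<in> \<tau>"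
      using Union_pr_classD[OF assms(1), of X] unfolding pr_radical_def coprod X_def by blast
    let ?m = "whisker C r (Tgt d)"
    note m = wh[OF rs] and d = cok[OF rs(1,2)]
    obtain e where e: "is_cokernel ?F e ?m" using ex_cokernel_fc[OF cat ab] m(1) by (auto simp: Hom_fc)
    have eH: "e \<in> Hom ?F (Tgt d) (Tgt e)" using is_cokernelD(2)[OF e] m(1) by (simp add: Hom_fc fc_sel(4))
    note ed = F.Comp_Hom[OF d eH]
    have "is_kernel ?F p (e \<odot>\<^bsub>?F\<^esub> d)" using F.kernel_pullback[OF pb monic_normal_fc[OF cat ab m(2) e]] .
    then have "is_kernel ?F s (e \<odot>\<^bsub>?F\<^esub> d)"
      using F.kernel_equiv[of p "e \<odot>\<^bsub>?F\<^esub> d" s] Pr_arrow[OF assms(1) rs(2)] Pr_mem_iff[OF assms(1) p, of s] rs(2)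
        ed by (simp add: Hom_fc fc_sel(3,4))
    then have "is_cokernel ?F (e \<odot>\<^bsub>?F\<^esub> d) s"
      \<comment> \<open>A composite of two cokernels is epic, so it is a cokernel of its kernel
        \<open>s\<close>.\<close>
      using epic_normal_fc[OF cat ab F.epic_comp[OF F.cokernel_epic[OF rs(1)] F.cokernel_epic[OF e] d eH]] by blast
    moreover have "factors_through ?F s s" using F.factors_through_refl is_cokernelD(1)[OF rs(1)] by (simp add: Hom_def)
    ultimately obtain v where v: "v \<in> Hom ?F (Cod ?F (e \<odot>\<^bsub>?F\<^esub> d)) (Cod ?F d)" "v \<odot>\<^bsub>?F\<^esub> (e \<odot>\<^bsub>?F\<^esub> d) = d"
      using F.cokernels_factor[OF _ rs(1)] by blast
    note v = v[unfolded HomD[OF ed, THEN conjunct2, THEN conjunct2] HomD[OF d, THEN conjunct2, THEN conjunct2]]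
    have "(v \<odot>\<^bsub>?F\<^esub> e) \<odot>\<^bsub>?F\<^esub> d = Id ?F (Tgt d) \<odot>\<^bsub>?F\<^esub> d"
      using F.Comp_assoc[OF d eH v(1)] v(2) F.Id_Comp[OF d] by simp
    then have "v \<odot>\<^bsub>?F\<^esub> e = Id ?F (Tgt d)"
      using epicD[OF F.cokernel_epic[OF rs(1)] d F.Comp_Hom[OF eH v(1)]] F.Id_Hom[OF F.Hom_Obj(2)[OF d]] by blast
    then have "monic ?F e" using F.monic_left_invertible[OF eH v(1)] by blast
    then have "zero_arrow ?F ?m" using F.monic_reflects_zero[OF _ eH m(1)] is_cokernelD(3)[OF e] by blast
    then show "\<forall>a \<in> Obj C. zero_arrow C (Cpt t (FObj (Tgt c) a))"
      using wz[OF rs] transfer[OF rs assms(3,2,2)] by blast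
  next
    assume zero: "\<forall>a \<in> Obj C. zero_arrow C (Cpt t (FObj (Tgt c) a))"
    \<comment> \<open>The converse: \<open>s\<close> is the kernel of its cokernel \<open>d\<close>,
      and pulling back a zero monic along \<open>d\<close> gives exactly that kernel.\<close>
    have pb: "\<exists>q. is_pullback ?F d (whisker C r (Tgt d)) s q"
      if rs: "is_cokernel ?F d s" "s \<in> \<tau>" "r \<in> \<tau>" for r s d
    proof (rule F.pullback_zero_monic)
      show "is_kernel ?F s d" using monic_normal_fc[OF cat ab Pr_arrow(1)[OF assms(1) rs(2)] rs(1)] .
      show "monic ?F (whisker C r (Tgt d))" using wh(2)[OF rs] .
      show "zero_arrow ?F (whisker C r (Tgt d))" using wz[OF rs] transfer[OF assms(3,2,2) rs] zero by blast
      show "Cod ?F (whisker C r (Tgt d)) = Cod ?F d" using wh(1)[OF rs] by (simp add: Hom_fc fc_sel(4))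
    qed
    have "X \<subseteq> \<tau>"
    proof
      fix p assume "p \<in> X"
      then obtain q s r d where rs: "is_cokernel ?F d s" "s \<in> \<tau>" "r \<in> \<tau>"
        and p: "is_pullback ?F d (whisker C r (Tgt d)) p q" unfolding X_def by blast
      obtain q' where q': "is_pullback ?F d (whisker C r (Tgt d)) s q'" using pb[OF rs] by blast
      \<comment> \<open>The cokernel \<open>e\<close> presents the whiskered monic as a kernel, so
        that \<open>kernel_pullback\<close> makes the arbitrary pullback \<open>p\<close>
        monic.\<close>
      obtain e where e: "is_cokernel ?F e (whisker C r (Tgt d))"
        using ex_cokernel_fc[OF cat ab] wh(1)[OF rs] by (auto simp: Hom_fc)
      have "monic ?F p" using F.kernel_monic[OF F.kernel_pullback[OF p monic_normal_fc[OF cat ab wh(2)[OF rs] e]]] .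
      moreover have "Tgt p = id_functor C" using F.is_pullbackD(3)[OF p] cok[OF rs(1,2)] by (simp add: Hom_fc fc_sel(3))
      ultimately show "p \<in> \<tau>"
        using Pr_mem_iff[OF assms(1) rs(2)] F.pullbacks_factor[OF p q'] F.pullbacks_factor[OF q' p] by blast
    qed
    moreover have "t \<in> X" using pb[OF assms(3,2,2)] assms(2,3) unfolding X_def by blast
    ultimately show "pr_radical C \<tau>" using Union_pr_classI[OF assms(1)] unfolding pr_radical_def coprod by blast
  qed
qed

text \<open>The criterion moved from \<open>t\<close> to \<open>c\<close>: it now has the shape of
  the idempotence criterion, with the target of \<open>c\<close> in place of the source of
  \<open>t\<close>.\<close>

lemma (in abelian_category) pr_radical_iff:
  assumes "\<tau> \<in> Pr C" "t \<in> \<tau>" "is_cokernel (functor_category C C) c t"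
  shows "pr_radical C \<tau> \<longleftrightarrow> (\<forall>a \<in> Obj C. invertible C (Cpt c (FObj (Tgt c) a)))"
proof -
  have "is_functor C C (Tgt c)" using assms(3) by (simp add: is_cokernel_def fc_sel is_nat_trans_def)
  then have "is_cokernel C (Cpt c (FObj (Tgt c) a)) (Cpt t (FObj (Tgt c) a))" if "a \<in> Obj C" for a
    using is_cokernel_fcD[OF category_axioms abelian_category_axioms assms(3)] is_functorD(1) that by metis
  then show ?thesis using pr_radical_iff_zero[OF assms] invertible_cokernel_iff by blast
qed

theorem corollary3p11:
  fixes C :: "('o, 'm) cat" and \<tau> :: "('o, 'm) preradical"
  assumes "abelian_category C" and "\<tau> \<in> Pr C"
  shows "(pr_radical C \<tau> \<longleftrightarrow> pr_idempotent (op_cat C) (pr_dual C \<tau>)) \<and>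
         (pr_idempotent C \<tau> \<longleftrightarrow> pr_radical (op_cat C) (pr_dual C \<tau>))"
proof -
  interpret C: abelian_category C by fact
  interpret op: abelian_category "op_cat C" using abelian_category_op assms(1) .
  let ?F = "functor_category C C" and ?G = "functor_category (op_cat C) (op_cat C)"
  note cat = C.category_axioms
  interpret F: category ?F using category_fc cat cat .
  interpret G: category ?G using category_fc op.category_axioms op.category_axioms .
  obtain t where t: "t \<in> \<tau>" using C.Pr_nonempty[OF assms(2)] by blast
  note tm = C.Pr_arrow[OF assms(2) t]
  obtain c where c: "is_cokernel ?F c t" using ex_cokernel_fc[OF cat assms(1) tm(2)] by blast
  have tc: "is_cokernel ?G (op_nat_trans t) (op_nat_trans c)"
    using monic_normal_fc[OF cat assms(1) tm(1) c] by (simp add: is_cokernel_fc_op)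
  note dual = pr_dual_in_Pr[OF assms]
  have "op_nat_trans c \<in> pr_class (op_cat C) (op_nat_trans c)"
  proof -
    have "monic ?G (op_nat_trans c)" using monic_op[OF F.cokernel_epic[OF c]] .
    moreover have "Src c = id_functor C" using c tm(3) by (simp add: is_cokernel_def fc_sel)
    ultimately have "op_nat_trans c \<in> monics_into ?G (id_functor (op_cat C))"
      by (simp add: monics_into_def fc_sel op_nt_sel id_functor_op)
    then show ?thesis unfolding pr_class_def using equiv_class_self[OF G.equiv_sub_equiv] by blast
  qed
  \<comment> \<open>\<open>pr_dual C \<tau>\<close> is a union over choices, but it is known to be a
    single class, so this one member can serve as its representative.\<close>
  then have cd: "op_nat_trans c \<in> pr_dual C \<tau>" unfolding pr_dual_def using t c by blast
  show ?thesis
    \<comment> \<open>On the dual side the representative is \<open>op_nat_trans c\<close> with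
      cokernel \<open>op_nat_trans t\<close>. Its source is \<open>Tgt c\<close>, the target of that
      cokernel is \<open>Src t\<close>, and invertibility is self-dual, so both equivalences become
      identities.\<close>
    unfolding C.pr_radical_iff[OF assms(2) t c] C.pr_idempotent_iff[OF assms(2) t]
      op.pr_radical_iff[OF dual cd tc] op.pr_idempotent_iff[OF dual cd]
    by (simp add: op_nt_sel op_sel invertible_op)
qed

end
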